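(* Let $\tilde b,d\ge1$ be integers, let $B$ be a large number and let $\mathcal{K}\subset\mathbb{R}^{\tilde b}$ be a compact set. Choose constants $C,C'$ (depending on $\mathcal{K},\tilde b,d$) and $C''$ (depending on $C,C',\mathcal{K},\tilde b,d$) large enough. Assume $\lambda'\in\mathcal{K}$ satisfies $$|P(\lambda')|>B^{-C'}$$ for all polynomials $P(X)\in\mathbb{Z}[X_1,\dots,X_{\tilde b}]$, $P\neq0$, of degree less than $10d$ and with coefficients $|a_\beta|<B^{C}$. Consider a sequence $(\xi_j)_{1\le j\le k}$ of distinct elements of $\mathbb{Z}^{d+\tilde b}$, written $\xi_j=(n_j,k_j)$ with $n_j\in\mathbb{Z}^d$, $k_j\in\mathbb{Z}^{\tilde b}$, such that, for some $\sigma\in\mathbb{R}$, $$\big|(\lambda'\cdot k_j+\sigma)^2-|n_j|^2\big|<B\quad\text{for all }1\le j\le k,$$ and $$|\xi_j-\xi_{j-1}|<B\quad\text{for all }2\le j\le k.$$ Furthermore, assume that $$\max_{n}\,\#\{1\le j\le k: n_j=n\}<B'.$$ Then $$k<(BB')^{C''}.$$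
   Context: $|\cdot|$ is the Euclidean norm on vectors and $\lambda'\cdot k_j$ is the Euclidean inner product in $\mathbb{R}^{\tilde b}$. The $a_\beta$ are the coefficients of $P=\sum_\beta a_\beta X^\beta$. The maximum is over $n\in\mathbb{Z}^d$. The constants $C,C',C''$ are independent of $B,B',\sigma,\lambda',k$ and of the sequence $(\xi_j)$; "$B$ large" means $B$ larger than a threshold depending only on $\mathcal{K},\tilde b,d$ and these constants. *)

theory Defs
  imports "HOL-Analysis.Analysis" "HOL-Library.Poly_Mapping"
begin

text \<open>
  Polynomials in \<open>\<int>[X\<^sub>i : i \<in> 'b]\<close> are finitely supported maps from exponents
  \<open>\<beta> :: 'b \<Rightarrow>\<^sub>0 nat\<close> to coefficients; the coefficient \<open>a\<^sub>\<beta>\<close> of \<open>P\<close> is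
  \<open>lookup P \<beta>\<close>.
\<close>

type_synonym 'b int_mpoly = "('b \<Rightarrow>\<^sub>0 nat) \<Rightarrow>\<^sub>0 int"

text \<open>The \<open>insert 0\<close> only serves to give the zero polynomial degree \<open>0\<close>.\<close>

definition total_degree :: "'b int_mpoly \<Rightarrow> nat" where
  "total_degree P = Max (insert 0 ((\<lambda>\<beta>. \<Sum>i\<in>Poly_Mapping.keys \<beta>. Poly_Mapping.lookup \<beta> i) ` Poly_Mapping.keys P))"

definition eval_mpoly :: "('b::finite) int_mpoly \<Rightarrow> real ^ 'b \<Rightarrow> real" where
  "eval_mpoly P x =
    (\<Sum>\<beta>\<in>Poly_Mapping.keys P. real_of_int (Poly_Mapping.lookup P \<beta>) * (\<Prod>i\<in>UNIV. (x $ i) ^ Poly_Mapping.lookup \<beta> i))"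

definition real_vec :: "int ^ 'n \<Rightarrow> real ^ 'n" where
  "real_vec v = (\<chi> i. real_of_int (v $ i))"

text \<open>
  Points of \<open>\<int>\<^bsup>d + b\<^esup>\<close> are pairs \<open>(n, k)\<close>.  The norm of the product type is
  \<open>norm (x, y) = sqrt ((norm x)\<^sup>2 + (norm y)\<^sup>2)\<close>, so this is the Euclidean norm.
\<close>

definition lattice_norm :: "(int ^ 'd) \<times> (int ^ 'b) \<Rightarrow> real" where
  "lattice_norm \<xi> = norm (real_vec (fst \<xi>), real_vec (snd \<xi>))"

end

theory Submission
  imports Defs
begin

text \<open>
  Map a point \<open>(n, k)\<close> to \<open>(lam \<bullet> k + \<sigma>, n)\<close> in \<open>\<real> \<times> \<real>\<^sup>d\<close>. The chain then stays near
  the cone of the quadratic form \<open>t\<^sup>2 - |n|\<^sup>2\<close> while its steps are short, so each of its points is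
  almost orthogonal, for this form, to all steps taken nearby (\<open>pair_step_le\<close>). On the span of these
  steps the form turns out to be nondegenerate, with a quantitative lower bound coming from the
  Diophantine condition. Hence the component of the point in that span is bounded. If every
  window of \<open>L\<close> consecutive steps spans the same space as the whole chain, this applies to all
  points with the same span; as they differ by vectors of the span, their positions \<open>n\<close> lie in
  one ball whose radius is polynomial in \<open>B\<close> and linear in \<open>L\<close> (\<open>displacement_le\<close>). Such a ball has few lattice points, and
  each is visited less than \<open>B'\<close> times. If on the other hand some window spans less, induction on
  the dimension bounds \<open>L\<close> (\<open>chain_length_le\<close>). The dimension is at most \<open>d\<close> plus the
  number of coordinates of \<open>lam\<close>, so the final exponent depends on the constants only.

  Nondegeneracy is the delicate point, since the form is indefinite and the span could meet the cone.
  Integral Gram-Schmidt orthogonalisation of the \<open>n\<close>-components of the steps, carried along on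
  the \<open>k\<close>-components, leads to two cases (\<open>orthogonal_frame_dichotomy\<close>), with integers bounded by a
  fixed power of \<open>B\<close> however many steps there are.

  \<^item> It produces some \<open>(0, \<kappa>)\<close> with \<open>\<kappa> \<noteq> 0\<close>. Then \<open>lam \<bullet> \<kappa>\<close> is not small, and
    near-orthogonality to \<open>(lam \<bullet> \<kappa>, 0)\<close> bounds the time coordinate \<open>lam \<bullet> k + \<sigma>\<close>.
  \<^item> It produces \<open>(w\<^sub>i, \<kappa>\<^sub>i)\<close> with nonzero orthogonal \<open>w\<^sub>i\<close>, spanning all steps. Then the span is
    the graph of \<open>w \<mapsto> g \<bullet> w\<close> with \<open>|g|\<^sup>2 = \<Sum> (lam \<bullet> \<kappa>\<^sub>i)\<^sup>2 / |w\<^sub>i|\<^sup>2\<close>, and the form degenerates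
    only if \<open>|g|\<^sup>2 = 1\<close>. Multiplied by the product \<open>D\<close> of all \<open>|w\<^sub>i|\<^sup>2\<close>, the number \<open>|g|\<^sup>2 - 1\<close>
    becomes an integral quadratic polynomial in \<open>lam\<close>. Its constant term is \<open>- D\<close>, so it is not the zero
    polynomial, and the Diophantine condition keeps it away from zero (\<open>frame_graph\<close>).
\<close>

section \<open>Integer quadratic polynomials\<close>

definition quadratic_mpoly :: "int \<Rightarrow> ('b \<Rightarrow> 'b \<Rightarrow> int) \<Rightarrow> ('b::finite) int_mpoly" where
  "quadratic_mpoly a A = Poly_Mapping.single 0 a
     + (\<Sum>p\<in>UNIV. \<Sum>q\<in>UNIV. Poly_Mapping.single (Poly_Mapping.single p 1 + Poly_Mapping.single q 1) (A p q))"

lemma eval_mpoly_superset: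
  assumes "finite F" "Poly_Mapping.keys P \<subseteq> F"
  shows "eval_mpoly P x =
    (\<Sum>\<beta>\<in>F. real_of_int (Poly_Mapping.lookup P \<beta>) * (\<Prod>i\<in>UNIV. (x $ i) ^ Poly_Mapping.lookup \<beta> i))"
  unfolding eval_mpoly_def using assms
  by (intro sum.mono_neutral_left) (auto simp: in_keys_iff)

lemma eval_mpoly_add: "eval_mpoly (P + Q) x = eval_mpoly P x + eval_mpoly Q x"
proof -
  let ?F = "Poly_Mapping.keys P \<union> Poly_Mapping.keys Q"
  have "Poly_Mapping.keys (P + Q) \<subseteq> ?F" by (rule Poly_Mapping.keys_add)
  then show ?thesis
    by (simp add: eval_mpoly_superset[of ?F] lookup_add distrib_right sum.distrib)
qed

lemma eval_mpoly_zero: "eval_mpoly 0 x = 0"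
  by (simp add: eval_mpoly_def)

lemma eval_mpoly_sum: "eval_mpoly (\<Sum>i\<in>I. P i) x = (\<Sum>i\<in>I. eval_mpoly (P i) x)"
  by (induction I rule: infinite_finite_induct) (auto simp: eval_mpoly_add eval_mpoly_zero)

lemma eval_mpoly_single:
  "eval_mpoly (Poly_Mapping.single \<beta> a) x = real_of_int a * (\<Prod>i\<in>UNIV. (x $ i) ^ Poly_Mapping.lookup \<beta> i)"
  by (subst eval_mpoly_superset[of "{\<beta>}"]) auto

lemma prod_power_unit_exponent:
  "(\<Prod>i\<in>UNIV. (x $ i :: real) ^ Poly_Mapping.lookup (Poly_Mapping.single p (1::nat)) i) = x $ p"
proof -
  have "(\<Prod>i\<in>UNIV. (x $ i :: real) ^ Poly_Mapping.lookup (Poly_Mapping.single p (1::nat)) i)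
      = (\<Prod>i\<in>UNIV. if i = p then x $ i else 1)"
    by (intro prod.cong) (auto simp: lookup_single when_def)
  then show ?thesis by simp
qed

lemma eval_quadratic_mpoly:
  "eval_mpoly (quadratic_mpoly a A) x = a + (\<Sum>p\<in>UNIV. \<Sum>q\<in>UNIV. A p q * (x $ p * x $ q))"
proof -
  have monomial: "eval_mpoly (Poly_Mapping.single (Poly_Mapping.single p 1 + Poly_Mapping.single q 1) c) x
     = real_of_int c * (x $ p * x $ q)" for p q c
    by (simp add: eval_mpoly_single lookup_add power_add prod.distrib
        prod_power_unit_exponent[simplified])
  show ?thesis
    unfolding quadratic_mpoly_def eval_mpoly_add eval_mpoly_sum monomial
    by (simp add: eval_mpoly_single)
qed

lemma lookup_sum_mpoly:
  "Poly_Mapping.lookup (\<Sum>i\<in>I. P i) \<beta> = (\<Sum>i\<in>I. Poly_Mapping.lookup (P i) \<beta>)"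
  by (induction I rule: infinite_finite_induct) (auto simp: lookup_add)

lemma lookup_quadratic_mpoly:
  "Poly_Mapping.lookup (quadratic_mpoly a A) \<beta> = (a when 0 = \<beta>)
     + (\<Sum>p\<in>UNIV. \<Sum>q\<in>UNIV. A p q when Poly_Mapping.single p 1 + Poly_Mapping.single q 1 = \<beta>)"
  by (simp add: quadratic_mpoly_def lookup_add lookup_sum_mpoly lookup_single)

text \<open>
  The exponents of \<open>X\<^sub>p X\<^sub>q\<close> and \<open>X\<^sub>q X\<^sub>p\<close> coincide, so a single coefficient is a sum of
  entries of \<open>A\<close>; the sum of all entries bounds it without deciding which ones collide.
\<close>

lemma abs_lookup_quadratic_mpoly_le:
  "\<bar>Poly_Mapping.lookup (quadratic_mpoly a A) \<beta>\<bar> \<le> \<bar>a\<bar> + (\<Sum>p\<in>UNIV. \<Sum>q\<in>UNIV. \<bar>A p q\<bar>)"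
  unfolding lookup_quadratic_mpoly
  by (intro order.trans[OF abs_triangle_ineq] add_mono order.trans[OF sum_abs] sum_mono)
     (auto simp: when_def)

lemma unit_exponent_sum_ne_0: "Poly_Mapping.single p (1::nat) + Poly_Mapping.single q 1 \<noteq> 0"
proof
  assume "Poly_Mapping.single p (1::nat) + Poly_Mapping.single q 1 = 0"
  then have "Poly_Mapping.lookup (Poly_Mapping.single p (1::nat) + Poly_Mapping.single q 1) p = 0"
    by simp
  then show False by (simp add: lookup_add)
qed

lemma unit_exponent_sum_eq_square:
  "Poly_Mapping.single q (1::nat) + Poly_Mapping.single r 1
     = Poly_Mapping.single p 1 + Poly_Mapping.single p 1 \<longleftrightarrow> q = p \<and> r = p"
proof
  assume "Poly_Mapping.single q (1::nat) + Poly_Mapping.single r 1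
     = Poly_Mapping.single p 1 + Poly_Mapping.single p 1"
  then have "Poly_Mapping.lookup (Poly_Mapping.single q (1::nat) + Poly_Mapping.single r 1) p
      = Poly_Mapping.lookup (Poly_Mapping.single p (1::nat) + Poly_Mapping.single p 1) p" by simp
  then show "q = p \<and> r = p" by (auto simp: lookup_add lookup_single when_def split: if_splits)
qed simp

text \<open>
  The constant term and the coefficients of the squares \<open>X\<^sub>p\<^sup>2\<close> are the two kinds of coefficient
  in which no two entries can cancel.
\<close>

lemma quadratic_mpoly_ne_0:
  assumes "a \<noteq> 0 \<or> A p p \<noteq> 0"
  shows "quadratic_mpoly a A \<noteq> 0"
proof
  assume z: "quadratic_mpoly a A = 0"
  have "Poly_Mapping.lookup (quadratic_mpoly a A) 0 = a"
    unfolding lookup_quadratic_mpoly by (simp add: unit_exponent_sum_ne_0[simplified])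
  moreover have "Poly_Mapping.lookup (quadratic_mpoly a A)
      (Poly_Mapping.single p 1 + Poly_Mapping.single p 1)
      = (\<Sum>q\<in>UNIV. \<Sum>r\<in>UNIV. if q = p \<and> r = p then A q r else 0)"
    unfolding lookup_quadratic_mpoly unit_exponent_sum_eq_square
    using unit_exponent_sum_ne_0[of p p] by (simp add: when_def del: single_add)
  moreover have "\<dots> = (\<Sum>q\<in>UNIV. if q = p then \<Sum>r\<in>UNIV. if r = p then A q r else 0 else 0)"
    by (intro sum.cong) auto
  ultimately show False using assms z by simp
qed

lemma total_degree_quadratic_mpoly: "total_degree (quadratic_mpoly a A) \<le> 2"
proof -
  have "(\<Sum>i\<in>Poly_Mapping.keys \<beta>. Poly_Mapping.lookup \<beta> i) \<le> 2"
    if "\<beta> \<in> Poly_Mapping.keys (quadratic_mpoly a A)" for \<beta>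
  proof -
    have eq: "(\<Sum>i\<in>Poly_Mapping.keys \<beta>. Poly_Mapping.lookup \<beta> i) = (\<Sum>i\<in>UNIV. Poly_Mapping.lookup \<beta> i)"
      by (intro sum.mono_neutral_left) (auto simp: in_keys_iff)
    have "\<beta> = 0 \<or> (\<exists>p q. Poly_Mapping.single p 1 + Poly_Mapping.single q 1 = \<beta>)"
    proof (rule ccontr)
      assume "\<not> ?thesis"
      then have "Poly_Mapping.lookup (quadratic_mpoly a A) \<beta> = 0"
        unfolding lookup_quadratic_mpoly by (auto simp: when_def)
      then show False using that by (simp add: in_keys_iff)
    qed
    then show ?thesis unfolding eq
      by (auto simp: lookup_add lookup_single when_def sum.distrib)
  qed
  then show ?thesis by (auto simp: total_degree_def)
qed

section \<open>Lower bounds for integral quadratic expressions\<close>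

definition int_vec :: "real ^ 'n \<Rightarrow> bool" where
  "int_vec v \<longleftrightarrow> (\<forall>i. v $ i \<in> \<int>)"

text \<open>
  A combination of squares of integral linear forms with positive integral weights has a
  coefficient matrix with nonnegative diagonal, and a positive diagonal entry as soon as one of
  the forms is nonzero. Hence a constant term or a nonzero form already makes the polynomial
  nonzero, and the Diophantine hypothesis applies to it.
\<close>

lemma nonresonance:
  fixes lam :: "real ^ 'b::finite" and \<kappa> :: "'i \<Rightarrow> real ^ 'b"
  assumes dioph: "\<And>P :: 'b int_mpoly. P \<noteq> 0 \<Longrightarrow> total_degree P \<le> 2 \<Longrightarrow>
      (\<And>\<beta>. \<bar>real_of_int (Poly_Mapping.lookup P \<beta>)\<bar> < M) \<Longrightarrow> \<bar>eval_mpoly P lam\<bar> > \<delta>"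
    and "finite J"
    and a: "a \<in> \<int>" "\<bar>a\<bar> \<le> H"
    and D: "\<And>i. i \<in> J \<Longrightarrow> D i \<in> \<int>" "\<And>i. i \<in> J \<Longrightarrow> 0 < D i" "\<And>i. i \<in> J \<Longrightarrow> D i \<le> H"
    and \<kappa>: "\<And>i. i \<in> J \<Longrightarrow> int_vec (\<kappa> i)" "\<And>i. i \<in> J \<Longrightarrow> norm (\<kappa> i) \<le> R"
    and size: "H + real CARD('b) ^ 2 * (real (card J) * (H * R\<^sup>2)) < M"
    and nz: "a \<noteq> 0 \<or> (\<exists>i\<in>J. \<kappa> i \<noteq> 0)"
  shows "\<bar>a + (\<Sum>i\<in>J. D i * (lam \<bullet> \<kappa> i)\<^sup>2)\<bar> > \<delta>"
proof -
  define a' where "a' = \<lfloor>a\<rfloor>"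
  define A where "A p q = \<lfloor>\<Sum>i\<in>J. D i * (\<kappa> i $ p * \<kappa> i $ q)\<rfloor>" for p q
  have a': "real_of_int a' = a" using a by (simp add: a'_def)
  have A: "real_of_int (A p q) = (\<Sum>i\<in>J. D i * (\<kappa> i $ p * \<kappa> i $ q))" for p q
  proof -
    have "(\<Sum>i\<in>J. D i * (\<kappa> i $ p * \<kappa> i $ q)) \<in> \<int>" (is "?s \<in> _")
      using D(1) \<kappa>(1) unfolding int_vec_def by (intro Ints_sum Ints_mult) blast+
    then obtain m :: int where "?s = of_int m" by (rule Ints_cases)
    then show ?thesis by (simp only: A_def floor_of_int)
  qed
  have nz': "\<exists>p. a' \<noteq> 0 \<or> A p p \<noteq> 0"
  proof (cases "a = 0")
    case True
    then obtain i p where ip: "i \<in> J" "\<kappa> i $ p \<noteq> 0"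
      using nz by (metis vec_eq_iff zero_index)
    have "0 < D i * (\<kappa> i $ p * \<kappa> i $ p)"
      using D ip by (simp add: zero_less_mult_iff) (metis linorder_neqE_linordered_idom)
    also have "\<dots> \<le> (\<Sum>i\<in>J. D i * (\<kappa> i $ p * \<kappa> i $ p))"
      using D ip \<open>finite J\<close> by (intro member_le_sum) (auto simp: less_imp_le)
    finally show ?thesis using A[of p p] by (metis of_int_0 order_less_irrefl)
  next
    case False then show ?thesis using a' by auto
  qed
  have entry: "\<bar>D i * (\<kappa> i $ p * \<kappa> i $ q)\<bar> \<le> H * R\<^sup>2" if "i \<in> J" for i p q
  proof -
    have "\<bar>\<kappa> i $ p\<bar> \<le> R" "\<bar>\<kappa> i $ q\<bar> \<le> R"
      using component_le_norm_cart[of "\<kappa> i"] \<kappa>(2)[OF that] by (meson order.trans)+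
    then have "\<bar>\<kappa> i $ p\<bar> * \<bar>\<kappa> i $ q\<bar> \<le> R * R"
      by (intro mult_mono) auto
    then show ?thesis using D[OF that]
      by (auto simp: abs_mult power2_eq_square intro!: mult_mono)
  qed
  have "\<bar>real_of_int (A p q)\<bar> \<le> real (card J) * (H * R\<^sup>2)" for p q
    unfolding A by (rule order.trans[OF sum_abs sum_bounded_above]) (rule entry)
  then have "(\<Sum>p\<in>UNIV. \<Sum>q\<in>UNIV. \<bar>real_of_int (A p q)\<bar>)
      \<le> (\<Sum>p\<in>(UNIV::'b set). \<Sum>q\<in>(UNIV::'b set). real (card J) * (H * R\<^sup>2))"
    by (intro sum_mono)
  then have sumA: "(\<Sum>p\<in>UNIV. \<Sum>q\<in>UNIV. \<bar>real_of_int (A p q)\<bar>)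
      \<le> real CARD('b) ^ 2 * (real (card J) * (H * R\<^sup>2))"
    by (simp add: power2_eq_square mult_ac)
  have small: "\<bar>real_of_int (Poly_Mapping.lookup (quadratic_mpoly a' A) \<beta>)\<bar> < M" for \<beta>
  proof -
    have "real_of_int \<bar>Poly_Mapping.lookup (quadratic_mpoly a' A) \<beta>\<bar>
        \<le> real_of_int (\<bar>a'\<bar> + (\<Sum>p\<in>UNIV. \<Sum>q\<in>UNIV. \<bar>A p q\<bar>))"
      using abs_lookup_quadratic_mpoly_le[of a' A \<beta>] by (simp only: of_int_le_iff)
    then have "\<bar>real_of_int (Poly_Mapping.lookup (quadratic_mpoly a' A) \<beta>)\<bar>
        \<le> \<bar>a\<bar> + (\<Sum>p\<in>UNIV. \<Sum>q\<in>UNIV. \<bar>real_of_int (A p q)\<bar>)"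
      using a' by simp
    then show ?thesis using sumA a(2) size by linarith
  qed
  have "(\<Sum>p\<in>UNIV. \<Sum>q\<in>UNIV. A p q * (lam $ p * lam $ q)) = 
      (\<Sum>p\<in>UNIV. \<Sum>q\<in>UNIV. \<Sum>i\<in>J. D i * (\<kappa> i $ p * \<kappa> i $ q) * (lam $ p * lam $ q))"
    unfolding A by (simp add: sum_distrib_right)
  also have "\<dots> = (\<Sum>p\<in>UNIV. \<Sum>i\<in>J. \<Sum>q\<in>UNIV. D i * (\<kappa> i $ p * \<kappa> i $ q) * (lam $ p * lam $ q))"
    by (intro sum.cong refl sum.swap)
  also have "\<dots> = (\<Sum>i\<in>J. \<Sum>p\<in>UNIV. \<Sum>q\<in>UNIV. D i * (\<kappa> i $ p * \<kappa> i $ q) * (lam $ p * lam $ q))"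
    by (rule sum.swap)
  also have "\<dots> = (\<Sum>i\<in>J. D i * (lam \<bullet> \<kappa> i)\<^sup>2)"
    by (simp add: inner_vec_def power2_eq_square sum_product sum_distrib_left mult_ac)
  finally have "eval_mpoly (quadratic_mpoly a' A) lam = a + (\<Sum>i\<in>J. D i * (lam \<bullet> \<kappa> i)\<^sup>2)"
    by (simp add: eval_quadratic_mpoly a')
  moreover have "\<bar>eval_mpoly (quadratic_mpoly a' A) lam\<bar> > \<delta>"
    using nz' quadratic_mpoly_ne_0[of a' A] total_degree_quadratic_mpoly small
    by (intro dioph) blast+
  ultimately show ?thesis by simp
qed

section \<open>Integral Gram-Schmidt orthogonalisation\<close>

definition lattice_point :: "(real ^ 'd) \<times> (real ^ 'b) \<Rightarrow> bool" where
  "lattice_point z \<longleftrightarrow> int_vec (fst z) \<and> int_vec (snd z)"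

lemma lattice_point_diff: "lattice_point x \<Longrightarrow> lattice_point y \<Longrightarrow> lattice_point (x - y)"
  by (simp add: lattice_point_def int_vec_def)

lemma lattice_point_scaleR: "c \<in> \<int> \<Longrightarrow> lattice_point x \<Longrightarrow> lattice_point (c *\<^sub>R x)"
  by (simp add: lattice_point_def int_vec_def)

lemma lattice_point_sum: "(\<And>i. i \<in> I \<Longrightarrow> lattice_point (f i)) \<Longrightarrow> lattice_point (\<Sum>i\<in>I. f i)"
  by (simp add: lattice_point_def int_vec_def fst_sum snd_sum Ints_sum)

lemma int_vec_inner: "int_vec x \<Longrightarrow> int_vec y \<Longrightarrow> x \<bullet> y \<in> \<int>"
  by (auto simp: int_vec_def inner_vec_def)

text \<open>
  Squared lengths are the denominators of orthogonal projections; integrality keeps them away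
  from zero.
\<close>

lemma one_le_inner_int_vec:
  assumes "int_vec x" "x \<noteq> 0"
  shows "1 \<le> x \<bullet> x"
proof -
  have "x \<bullet> x \<in> \<int>" "0 < x \<bullet> x" using assms int_vec_inner by auto
  then obtain m :: int where "x \<bullet> x = of_int m" "0 < m" by (metis Ints_cases of_int_0_less_iff)
  then show ?thesis by simp
qed

lemma inner_scaleR_unfold_sum:
  fixes Z :: "('a::real_inner \<times> 'c::real_vector) set"
  assumes "finite Z" "\<And>z. z \<in> Z \<Longrightarrow> z \<noteq> w \<Longrightarrow> fst z \<bullet> fst w = 0" "w \<in> Z"
  shows "(\<Sum>z\<in>Z. c z * (fst z \<bullet> fst w)) = c w * (fst w \<bullet> fst w)"
proof -
  have "(\<Sum>z\<in>Z. c z * (fst z \<bullet> fst w)) = (\<Sum>z\<in>Z. if z = w then c z * (fst z \<bullet> fst w) else 0)"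
    using assms(2) by (intro sum.cong) auto
  then show ?thesis using assms by simp
qed

text \<open>
  The first components are orthogonal, while the second components are carried along
  as lifts; \<open>p\<close> measures how complicated a combination of vectors of \<open>V\<close> is.
\<close>

definition orthogonal_frame ::
  "((real ^ 'd) \<times> (real ^ 'b) \<Rightarrow> real) \<Rightarrow> real \<Rightarrow> ((real ^ 'd) \<times> (real ^ 'b)) set \<Rightarrow> ((real ^ 'd) \<times> (real ^ 'b)) set \<Rightarrow> bool"
  where "orthogonal_frame p R V Z \<longleftrightarrow> finite Z \<and> Z \<subseteq> span V
    \<and> (\<forall>z\<in>Z. lattice_point z \<and> fst z \<noteq> 0 \<and> p z \<le> R)
    \<and> (\<forall>z\<in>Z. \<forall>z'\<in>Z. z \<noteq> z' \<longrightarrow> fst z \<bullet> fst z' = 0)"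

lemma orthogonal_frame_card_le:
  fixes Z :: "((real ^ 'd::finite) \<times> (real ^ 'b::finite)) set"
  assumes "orthogonal_frame p R V Z"
  shows "card Z \<le> CARD('d)"
proof -
  have inj: "inj_on fst Z"
  proof (rule inj_onI, rule ccontr)
    fix z z' assume z: "z \<in> Z" "z' \<in> Z" "fst z = fst z'" "z \<noteq> z'"
    then have "fst z \<bullet> fst z' = 0" "fst z \<noteq> 0" using assms unfolding orthogonal_frame_def by blast+
    then show False using z(3) by simp
  qed
  have "pairwise orthogonal (fst ` Z)" "0 \<notin> fst ` Z"
    using assms by (auto simp: orthogonal_frame_def pairwise_def orthogonal_def)
  then have "card (fst ` Z) \<le> CARD('d)"
    using independent_bound[OF pairwise_orthogonal_independent, of "fst ` Z"] by simp
  then show ?thesis using inj by (simp add: card_image)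
qed

lemma orthogonal_frame_prod:
  fixes Z :: "((real ^ 'd::finite) \<times> (real ^ 'b::finite)) set"
  assumes frame: "orthogonal_frame p R V Z" and p: "\<And>z. norm z \<le> p z" and R: "1 \<le> R" and "Y \<subseteq> Z"
  shows "(\<Prod>z\<in>Y. fst z \<bullet> fst z) \<in> \<int>" "1 \<le> (\<Prod>z\<in>Y. fst z \<bullet> fst z)"
    "(\<Prod>z\<in>Y. fst z \<bullet> fst z) \<le> R ^ (2 * CARD('d))"
proof -
  have Z: "int_vec (fst z)" "fst z \<noteq> 0" "norm (fst z) \<le> R" if "z \<in> Y" for z
  proof -
    have "z \<in> Z" using that assms(4) by blast
    then show "int_vec (fst z)" "fst z \<noteq> 0"
      using frame by (auto simp: orthogonal_frame_def lattice_point_def)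
    show "norm (fst z) \<le> R"
      using norm_fst_le[of "fst z" "snd z"] p[of z] frame \<open>z \<in> Z\<close>
      by (force simp: orthogonal_frame_def)
  qed
  have fin: "finite Z" using frame by (simp add: orthogonal_frame_def)
  show "(\<Prod>z\<in>Y. fst z \<bullet> fst z) \<in> \<int>" using Z by (intro Ints_prod int_vec_inner)
  show "1 \<le> (\<Prod>z\<in>Y. fst z \<bullet> fst z)" using Z by (intro prod_ge_1 one_le_inner_int_vec)
  have "(\<Prod>z\<in>Y. fst z \<bullet> fst z) \<le> (\<Prod>z\<in>Y. R\<^sup>2)"
    using Z by (intro prod_mono) (auto simp: dot_square_norm power_mono)
  also have "\<dots> = R ^ (2 * card Y)" by (simp add: power_mult)
  also have "\<dots> \<le> R ^ (2 * CARD('d))"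
    using R orthogonal_frame_card_le[OF frame] card_mono[OF fin assms(4)]
    by (intro power_increasing) auto
  finally show "(\<Prod>z\<in>Y. fst z \<bullet> fst z) \<le> R ^ (2 * CARD('d))" .
qed

lemma seminorm_sum_le:
  fixes p :: "'a::real_vector \<Rightarrow> real"
  assumes "\<And>c z. p (c *\<^sub>R z) \<le> \<bar>c\<bar> * p z" and "\<And>y z. p (y + z) \<le> p y + p z" and "finite Z"
  shows "p (\<Sum>z\<in>Z. c z *\<^sub>R f z) \<le> (\<Sum>z\<in>Z. \<bar>c z\<bar> * p (f z))"
  using assms(3)
proof (induction Z rule: finite_induct)
  case empty
  then show ?case using assms(1)[of 0 0] by simp
next
  case (insert z Z)
  have "p (\<Sum>z\<in>insert z Z. c z *\<^sub>R f z) \<le> p (c z *\<^sub>R f z) + p (\<Sum>z\<in>Z. c z *\<^sub>R f z)"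
    using insert assms(2) by simp
  then show ?case using insert assms(1)[of "c z" "f z"] by simp
qed

text \<open>
  Because the first components of a frame are orthogonal, they alone determine all coefficients.
\<close>

lemma orthogonal_frame_expansion:
  fixes Z :: "((real ^ 'd::finite) \<times> (real ^ 'b::finite)) set"
  assumes frame: "orthogonal_frame p R V Z" and w: "w \<in> span Z"
  shows "w = (\<Sum>z\<in>Z. (fst w \<bullet> fst z / (fst z \<bullet> fst z)) *\<^sub>R z)"
proof -
  have fin: "finite Z" using frame by (simp add: orthogonal_frame_def)
  obtain u where u: "w = (\<Sum>z\<in>Z. u z *\<^sub>R z)" using w span_finite[OF fin] by auto
  have "fst w \<bullet> fst z = u z * (fst z \<bullet> fst z)" "fst z \<noteq> 0" if "z \<in> Z" for z
  proof -
    have "fst w \<bullet> fst z = (\<Sum>y\<in>Z. u y * (fst y \<bullet> fst z))"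
      by (simp add: u fst_sum inner_sum_left)
    then show "fst w \<bullet> fst z = u z * (fst z \<bullet> fst z)"
      using inner_scaleR_unfold_sum[OF fin, of z u] frame that by (simp add: orthogonal_frame_def)
    show "fst z \<noteq> 0" using frame that by (simp add: orthogonal_frame_def)
  qed
  then have "(\<Sum>z\<in>Z. (fst w \<bullet> fst z / (fst z \<bullet> fst z)) *\<^sub>R z) = (\<Sum>z\<in>Z. u z *\<^sub>R z)"
    by (intro sum.cong) auto
  then show ?thesis using u by simp
qed

text \<open>
  One step of Gram-Schmidt, multiplied by the product of the squared lengths so that all
  coefficients are integers. These coefficients are at most \<open>R ^ (2 * CARD('d) + 2)\<close>, which gives the
  new bound. The result is nonzero because \<open>v\<close> is not in the span of the frame, but its first
  component may vanish.
\<close>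

lemma orthogonal_frame_step:
  fixes V :: "((real ^ 'd::finite) \<times> (real ^ 'b::finite)) set"
  assumes p: "\<And>c z. p (c *\<^sub>R z) \<le> \<bar>c\<bar> * p z" "\<And>y z. p (y + z) \<le> p y + p z" "\<And>z. norm z \<le> p z"
    and frame: "orthogonal_frame p R V Z"
    and v: "v \<in> V" "lattice_point v" "p v \<le> R" "v \<notin> span Z"
    and R: "1 + real CARD('d) \<le> R"
  shows "\<exists>\<zeta>. lattice_point \<zeta> \<and> \<zeta> \<in> span V \<and> \<zeta> \<noteq> 0 \<and> (\<forall>z\<in>Z. fst \<zeta> \<bullet> fst z = 0)
    \<and> p \<zeta> \<le> R ^ (2 * CARD('d) + 4)"
proof -
  define N where "N z = fst z \<bullet> fst z" for z :: "(real ^ 'd) \<times> (real ^ 'b)"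
  define D where "D = prod N Z"
  define c where "c z = prod N (Z - {z}) * (fst v \<bullet> fst z)" for z
  \<comment> \<open>Usual Gram-Schmidt divides the inner product by \<open>N z\<close>; the factor \<open>D\<close> turns this into the
    product over the other vectors.\<close>
  define \<zeta> where "\<zeta> = D *\<^sub>R v - (\<Sum>z\<in>Z. c z *\<^sub>R z)"
  have fin: "finite Z" and ZV: "Z \<subseteq> span V"
    and Z: "\<And>z. z \<in> Z \<Longrightarrow> lattice_point z" "\<And>z. z \<in> Z \<Longrightarrow> fst z \<noteq> 0" "\<And>z. z \<in> Z \<Longrightarrow> p z \<le> R"
    and orth: "\<And>z z'. z \<in> Z \<Longrightarrow> z' \<in> Z \<Longrightarrow> z \<noteq> z' \<Longrightarrow> fst z \<bullet> fst z' = 0"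
    using frame by (auto simp: orthogonal_frame_def)
  have cardZ: "card Z \<le> CARD('d)" using orthogonal_frame_card_le[OF frame] .
  have R1: "1 \<le> R" using R by simp
  have p_nonneg: "0 \<le> p z" for z by (rule order.trans[OF norm_ge_zero p(3)])
  have norm_fst: "norm (fst z) \<le> R" if "p z \<le> R" for z :: "(real ^ 'd) \<times> (real ^ 'b)"
    using norm_fst_le[of "fst z" "snd z"] p(3)[of z] that by simp
  have prod_bound: "prod N Y \<le> R ^ (2 * CARD('d))" and prod_pos: "1 \<le> prod N Y"
    and prod_int: "prod N Y \<in> \<int>" if "Y \<subseteq> Z" for Y
    using orthogonal_frame_prod[OF frame p(3) R1 that] by (simp_all add: N_def[abs_def])
  have c_int: "c z \<in> \<int>" if "z \<in> Z" for z
    using that Z v unfolding c_def lattice_point_def by (intro Ints_mult prod_int int_vec_inner) auto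
  have c_bound: "\<bar>c z\<bar> \<le> R ^ (2 * CARD('d) + 2)" if "z \<in> Z" for z
  proof -
    have "\<bar>fst v \<bullet> fst z\<bar> \<le> norm (fst v) * norm (fst z)" by (rule Cauchy_Schwarz_ineq2)
    also have "\<dots> \<le> R * R" using norm_fst v(3) Z(3)[OF that] R1 by (intro mult_mono) auto
    finally have "\<bar>prod N (Z - {z})\<bar> * \<bar>fst v \<bullet> fst z\<bar> \<le> R ^ (2 * CARD('d)) * (R * R)"
      using prod_bound[of "Z - {z}"] prod_pos[of "Z - {z}"] R1 by (intro mult_mono) auto
    then show ?thesis by (simp add: c_def abs_mult power_add power2_eq_square mult_ac)
  qed
  have "lattice_point \<zeta>"
    unfolding \<zeta>_def D_def using v Z c_int prod_int
    by (intro lattice_point_diff lattice_point_scaleR lattice_point_sum) auto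
  moreover have "\<zeta> \<in> span V"
    unfolding \<zeta>_def using v ZV by (intro span_diff span_scale span_sum) (auto intro: span_base)
  moreover have "\<zeta> \<noteq> 0"
  proof
    assume "\<zeta> = 0"
    then have "D *\<^sub>R v = (\<Sum>z\<in>Z. c z *\<^sub>R z)" by (simp add: \<zeta>_def)
    moreover have "(\<Sum>z\<in>Z. c z *\<^sub>R z) \<in> span Z" by (intro span_sum span_scale span_base)
    ultimately have "(1 / D) *\<^sub>R (D *\<^sub>R v) \<in> span Z" by (simp only: span_scale)
    then show False using v(4) prod_pos[of Z] by (simp add: D_def)
  qed
  moreover have "fst \<zeta> \<bullet> fst w = 0" if "w \<in> Z" for w
  proof -
    have "fst \<zeta> \<bullet> fst w = D * (fst v \<bullet> fst w) - (\<Sum>z\<in>Z. c z * (fst z \<bullet> fst w))"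
      by (simp add: \<zeta>_def fst_sum inner_diff_left inner_sum_left)
    also have "(\<Sum>z\<in>Z. c z * (fst z \<bullet> fst w)) = c w * (fst w \<bullet> fst w)"
      using fin orth that by (intro inner_scaleR_unfold_sum) auto
    also have "D = N w * prod N (Z - {w})"
      unfolding D_def using fin that by (rule prod.remove)
    finally show ?thesis by (simp add: c_def N_def)
  qed
  moreover have "p \<zeta> \<le> R ^ (2 * CARD('d) + 4)"
  proof -
    have "p \<zeta> \<le> p (D *\<^sub>R v) + p ((-1) *\<^sub>R (\<Sum>z\<in>Z. c z *\<^sub>R z))"
      using p(2)[of "D *\<^sub>R v" "(-1) *\<^sub>R (\<Sum>z\<in>Z. c z *\<^sub>R z)"] by (simp add: \<zeta>_def)
    also have "\<dots> \<le> \<bar>D\<bar> * p v + p (\<Sum>z\<in>Z. c z *\<^sub>R z)"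
      using p(1)[of D v] p(1)[of "-1" "\<Sum>z\<in>Z. c z *\<^sub>R z"] by simp
    also have "\<dots> \<le> \<bar>D\<bar> * p v + (\<Sum>z\<in>Z. \<bar>c z\<bar> * p z)"
      using seminorm_sum_le[of p, OF p(1,2) fin] by simp
    also have "\<dots> \<le> R ^ (2 * CARD('d)) * R + (\<Sum>z\<in>Z. R ^ (2 * CARD('d) + 2) * R)"
      using prod_bound[of Z] prod_pos[of Z] v(3) c_bound Z(3) R1
      by (intro add_mono mult_mono sum_mono) (auto simp: D_def p_nonneg)
    also have "\<dots> = R ^ (2 * CARD('d) + 1) + real (card Z) * R ^ (2 * CARD('d) + 3)"
      by (simp add: power_add power3_eq_cube power2_eq_square)
    also have "\<dots> \<le> R ^ (2 * CARD('d) + 3) + real CARD('d) * R ^ (2 * CARD('d) + 3)"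
      using R1 cardZ by (intro add_mono mult_right_mono power_increasing) auto
    also have "\<dots> = (1 + real CARD('d)) * R ^ (2 * CARD('d) + 3)" by (simp add: algebra_simps)
    also have "\<dots> \<le> R * R ^ (2 * CARD('d) + 3)"
      using R R1 by (intro mult_right_mono) auto
    finally show ?thesis by (simp flip: power_Suc add: numeral_eq_Suc)
  qed
  ultimately show ?thesis by blast
qed

text \<open>
  Raising to the power \<open>2 * d + 4\<close> is the cost of one orthogonalisation step, and \<open>d + 1\<close> steps
  would produce more orthogonal vectors than fit into dimension \<open>d\<close>.
\<close>

definition frame_exponent :: "nat \<Rightarrow> nat" where
  "frame_exponent d = (2 * d + 4) ^ (d + 1)"

text \<open>
  Gram-Schmidt goes on until it exhausts \<open>V\<close> or meets a vector whose first component reduces to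
  zero while its second does not. It cannot go on for longer than the dimension allows, which
  makes the bound independent of the size of \<open>V\<close>.
\<close>

lemma orthogonal_frame_dichotomy:
  fixes V :: "((real ^ 'd::finite) \<times> (real ^ 'b::finite)) set"
  assumes p: "\<And>c z. p (c *\<^sub>R z) \<le> \<bar>c\<bar> * p z" "\<And>y z. p (y + z) \<le> p y + p z" "\<And>z. norm z \<le> p z"
    and V: "\<And>v. v \<in> V \<Longrightarrow> lattice_point v" "\<And>v. v \<in> V \<Longrightarrow> p v \<le> B"
    and B: "1 + real CARD('d) \<le> B"
  defines "R \<equiv> B ^ frame_exponent CARD('d)"
  shows "(\<exists>\<zeta>\<in>span V. lattice_point \<zeta> \<and> fst \<zeta> = 0 \<and> snd \<zeta> \<noteq> 0 \<and> p \<zeta> \<le> R)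
    \<or> (\<exists>Z. orthogonal_frame p R V Z \<and> V \<subseteq> span Z)" (is "?vertical \<or> ?frame")
proof (rule ccontr)
  assume neg: "\<not> (?vertical \<or> ?frame)"
  have B1: "1 \<le> B" using B by simp
  let ?m = "2 * CARD('d) + 4"
  have "\<exists>Z. orthogonal_frame p (B ^ (?m ^ n)) V Z \<and> card Z = n" if "n \<le> CARD('d) + 1" for n
    using that
  proof (induction n)
    case 0
    have "orthogonal_frame p (B ^ (?m ^ 0)) V {}" by (simp add: orthogonal_frame_def)
    then show ?case by force
  next
    case (Suc n)
    define r where "r = B ^ (?m ^ n)"
    have "?m ^ Suc n \<le> frame_exponent CARD('d)"
      unfolding frame_exponent_def using Suc.prems by (intro power_increasing) auto
    then have rR: "r ^ ?m \<le> R"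
      unfolding r_def R_def power_mult[symmetric] using B1
      by (intro power_increasing) (auto simp: mult.commute)
    have Br: "B \<le> r" unfolding r_def using B1 by (intro self_le_power) auto
    have r_le: "r \<le> r ^ ?m" using Br B1 by (intro self_le_power) auto
    obtain Z where Z: "orthogonal_frame p r V Z" "card Z = n" using Suc r_def by auto
    have "orthogonal_frame p R V Z"
      using Z(1) r_le rR unfolding orthogonal_frame_def by (meson order.trans)
    then obtain v where v: "v \<in> V" "v \<notin> span Z" using neg by blast
    obtain \<zeta> where \<zeta>: "lattice_point \<zeta>" "\<zeta> \<in> span V" "\<zeta> \<noteq> 0"
        "\<forall>z\<in>Z. fst \<zeta> \<bullet> fst z = 0" "p \<zeta> \<le> r ^ ?m"
      using orthogonal_frame_step[OF p Z(1) v(1) V(1)[OF v(1)] _ v(2)] V(2)[OF v(1)] Br B by auto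
    have nz: "fst \<zeta> \<noteq> 0"
      using neg \<zeta> rR by (metis order.trans prod.collapse zero_prod_def)
    then have "\<zeta> \<notin> Z" using \<zeta>(4) by auto
    moreover have "orthogonal_frame p (r ^ ?m) V (insert \<zeta> Z)"
      using Z(1) \<zeta> nz r_le unfolding orthogonal_frame_def
      by (auto simp: inner_commute intro: order.trans)
    moreover have "r ^ ?m = B ^ (?m ^ Suc n)" by (simp add: r_def power_mult[symmetric] mult.commute)
    moreover have "finite Z" using Z(1) by (simp add: orthogonal_frame_def)
    ultimately show ?case using Z(2) by (intro exI[of _ "insert \<zeta> Z"]) simp
  qed
  then show False
    using orthogonal_frame_card_le[of p _ V] by (metis Suc_eq_plus1 not_less_eq_eq order_refl)
qed

section \<open>Chains near a light cone\<close>

text \<open>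
  The points are viewed in \<open>\<real> \<times> \<real>\<^sup>d\<close> through \<open>(n, k) \<mapsto> (lam \<bullet> k + \<sigma>, n)\<close>, where they lie near the
  light cone of the form \<open>t\<^sup>2 - |n|\<^sup>2\<close>. The lower bound on \<open>C\<close> makes the quadratic polynomials built
  from a frame of size \<open>B ^ frame_exponent CARD('d)\<close> admissible for the Diophantine condition.
\<close>

locale resonant_chain =
  fixes lam :: "real ^ 'b::finite" and \<sigma> B C C' \<Lambda> :: real
    and Y :: "nat \<Rightarrow> (real ^ 'd::finite) \<times> (real ^ 'b)" and k :: nat
  assumes lattice: "\<And>j. j \<in> {1..k} \<Longrightarrow> lattice_point (Y j)"
    and distinct: "inj_on Y {1..k}"
    and cone: "\<And>j. j \<in> {1..k} \<Longrightarrow> \<bar>(lam \<bullet> snd (Y j) + \<sigma>)\<^sup>2 - (norm (fst (Y j)))\<^sup>2\<bar> < B"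
    and steps: "\<And>j. j \<in> {2..k} \<Longrightarrow> norm (Y j - Y (j - 1)) < B"
    and dioph: "\<And>P :: 'b int_mpoly. P \<noteq> 0 \<Longrightarrow> total_degree P \<le> 2 \<Longrightarrow>
      (\<And>\<beta>. \<bar>real_of_int (Poly_Mapping.lookup P \<beta>)\<bar> < B powr C) \<Longrightarrow> \<bar>eval_mpoly P lam\<bar> > B powr (- C')"
    and lam_le: "norm lam \<le> \<Lambda>"
    and B_large: "5 + 4 * real CARD('d) + real CARD('d) * (real CARD('b))\<^sup>2 + \<Lambda>\<^sup>2 + real CARD('d) * \<Lambda> \<le> B"
    and C_large: "real (frame_exponent CARD('d) * (2 * CARD('d) + 2) + 2) \<le> C"
    and C'_nonneg: "0 \<le> C'"
begin

definition time :: "nat \<Rightarrow> real" where "time j = lam \<bullet> snd (Y j) + \<sigma>"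

text \<open>
  The polar form of \<open>t\<^sup>2 - |n|\<^sup>2\<close>, evaluated at the \<open>j\<close>-th point and the image of the direction \<open>z\<close>.
\<close>

definition pair :: "nat \<Rightarrow> (real ^ 'd) \<times> (real ^ 'b) \<Rightarrow> real" where
  "pair j z = time j * (lam \<bullet> snd z) - fst (Y j) \<bullet> fst z"

definition step_set :: "nat \<Rightarrow> nat \<Rightarrow> ((real ^ 'd) \<times> (real ^ 'b)) set" where
  "step_set s N = (\<lambda>i. Y i - Y (i - 1)) ` {s + 1..s + N}"

definition R :: real where "R = B ^ frame_exponent CARD('d)"

lemma Lam_nonneg: "0 \<le> \<Lambda>"
  using lam_le norm_ge_zero order.trans by blast

lemma B_bounds: "5 \<le> B" "1 + real CARD('d) \<le> B" "4 * real CARD('d) \<le> B"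
    "1 + real CARD('d) * (real CARD('b))\<^sup>2 \<le> B" "2 + \<Lambda>\<^sup>2 \<le> B" "real CARD('d) * \<Lambda> \<le> B"
proof -
  have "0 \<le> real CARD('d) * (real CARD('b))\<^sup>2" "0 \<le> \<Lambda>\<^sup>2" "0 \<le> real CARD('d) * \<Lambda>" "0 \<le> real CARD('d)"
    using Lam_nonneg by auto
  then show "5 \<le> B" "1 + real CARD('d) \<le> B" "4 * real CARD('d) \<le> B"
    "1 + real CARD('d) * (real CARD('b))\<^sup>2 \<le> B" "2 + \<Lambda>\<^sup>2 \<le> B" "real CARD('d) * \<Lambda> \<le> B"
    using B_large by linarith+
qed

lemma R_ge: "1 \<le> R"
  unfolding R_def using B_bounds(1) by (intro one_le_power) auto

lemma abs_lam_inner_le: "\<bar>lam \<bullet> v\<bar> \<le> \<Lambda> * norm v"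
  by (rule order.trans[OF Cauchy_Schwarz_ineq2 mult_right_mono[OF lam_le norm_ge_zero]])

lemma quadratic_lower_bound:
  fixes \<kappa> :: "'i \<Rightarrow> real ^ 'b"
  assumes "finite J" "card J \<le> CARD('d)"
    and "a \<in> \<int>" "\<bar>a\<bar> \<le> R ^ (2 * CARD('d))"
    and "\<And>i. i \<in> J \<Longrightarrow> D i \<in> \<int>" "\<And>i. i \<in> J \<Longrightarrow> 0 < D i" "\<And>i. i \<in> J \<Longrightarrow> D i \<le> R ^ (2 * CARD('d))"
    and "\<And>i. i \<in> J \<Longrightarrow> int_vec (\<kappa> i)" "\<And>i. i \<in> J \<Longrightarrow> norm (\<kappa> i) \<le> R"
    and "a \<noteq> 0 \<or> (\<exists>i\<in>J. \<kappa> i \<noteq> 0)"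
  shows "\<bar>a + (\<Sum>i\<in>J. D i * (lam \<bullet> \<kappa> i)\<^sup>2)\<bar> > B powr (- C')"
proof -
  let ?H = "R ^ (2 * CARD('d))" and ?b = "real CARD('b)" and ?d = "real CARD('d)"
  have "?H + ?b\<^sup>2 * (real (card J) * (?H * R\<^sup>2)) \<le> ?H * R\<^sup>2 + ?b\<^sup>2 * (?d * (?H * R\<^sup>2))"
    using assms(2) R_ge by (intro add_mono mult_mono) (auto intro!: mult_mono simp: mult_ge1_I)
  also have "\<dots> = (1 + ?d * ?b\<^sup>2) * (?H * R\<^sup>2)" by (simp add: algebra_simps)
  also have "\<dots> \<le> B * (?H * R\<^sup>2)"
    using B_bounds(4) R_ge by (intro mult_right_mono) auto
  also have "\<dots> < B * (B * (?H * R\<^sup>2))"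
    using B_bounds(1) R_ge by simp
  also have "\<dots> = B ^ (frame_exponent CARD('d) * (2 * CARD('d) + 2) + 2)"
    by (simp add: R_def power_add power_mult power2_eq_square power_mult_distrib)
  also have "\<dots> = B powr real (frame_exponent CARD('d) * (2 * CARD('d) + 2) + 2)"
    using B_bounds(1) by (intro powr_realpow[symmetric]) auto
  also have "\<dots> \<le> B powr C" using B_bounds(1) C_large by (intro powr_mono) auto
  finally have size: "?H + ?b\<^sup>2 * (real (card J) * (?H * R\<^sup>2)) < B powr C" .
  show ?thesis
    by (rule nonresonance[OF dioph assms(1,3,4,5,6,7,8,9) size assms(10)])
qed

text \<open>
  The square of a linear form is a quadratic expression, and squaring decreases numbers in the
  unit interval.
\<close>

lemma linear_lower_bound:
  assumes "int_vec \<kappa>" "norm \<kappa> \<le> R" "\<kappa> \<noteq> 0"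
  shows "B powr (- C') \<le> \<bar>lam \<bullet> \<kappa>\<bar>"
proof (cases "\<bar>lam \<bullet> \<kappa>\<bar> \<le> 1")
  case True
  have "B powr (- C') < \<bar>0 + (\<Sum>i\<in>{0::nat}. 1 * (lam \<bullet> \<kappa>)\<^sup>2)\<bar>"
    using assms R_ge by (intro quadratic_lower_bound) auto
  then have "B powr (- C') \<le> \<bar>lam \<bullet> \<kappa>\<bar>\<^sup>2" by simp
  also have "\<dots> \<le> \<bar>lam \<bullet> \<kappa>\<bar>"
    unfolding power2_eq_square using True by (intro mult_left_le) auto
  finally show ?thesis .
next
  case False
  have "B powr (- C') \<le> B powr 0" using B_bounds(1) C'_nonneg by (intro powr_mono) auto
  then show ?thesis using False B_bounds(1) by simp
qed

lemma chain_distance: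
  assumes "1 \<le> i" "i \<le> j" "j \<le> k"
  shows "norm (Y j - Y i) \<le> real (j - i) * B"
  using assms(2,3)
proof (induction j rule: dec_induct)
  case (step n)
  have "norm (Y (Suc n) - Y i) \<le> norm (Y (Suc n) - Y n) + norm (Y n - Y i)"
    using norm_triangle_ineq[of "Y (Suc n) - Y n" "Y n - Y i"] by simp
  also have "norm (Y (Suc n) - Y n) \<le> B"
    using steps[of "Suc n"] step assms(1) by simp
  also have "norm (Y n - Y i) \<le> real (n - i) * B" using step by simp
  finally show ?case using step by (simp add: Suc_diff_le algebra_simps)
qed simp

lemma window_distance:
  assumes "1 \<le> a" "a + L \<le> k" "i \<in> {a..a + L}" "j \<in> {a..a + L}"
  shows "norm (Y i - Y j) \<le> real L * B"
proof -
  have "norm (Y i - Y j) \<le> real (max i j - min i j) * B"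
    using chain_distance[of "min i j" "max i j"] assms
    by (cases "i \<le> j") (auto simp: norm_minus_commute max_def min_def)
  also have "\<dots> \<le> real L * B"
    using assms B_bounds(1) by (intro mult_right_mono) auto
  finally show ?thesis .
qed

lemma step_bounds:
  assumes "1 \<le> a" "a + L \<le> k" "v \<in> step_set a L"
  shows "lattice_point v" "norm v \<le> B" "v \<noteq> 0"
proof -
  obtain i where i: "v = Y i - Y (i - 1)" "i \<in> {2..k}" using assms by (auto simp: step_set_def)
  then have i': "i \<in> {1..k}" "i - 1 \<in> {1..k}" "i \<noteq> i - 1" by auto
  show "lattice_point v" unfolding i(1) by (rule lattice_point_diff[OF lattice[OF i'(1)] lattice[OF i'(2)]])
  show "norm v \<le> B" using i steps[of i] by simp
  show "v \<noteq> 0" using inj_onD[OF distinct _ i'(1,2)] i'(3) unfolding i(1) by (metis right_minus_eq)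
qed

text \<open>
  Two consecutive points have nearly the same value of the quadratic form, so a step is nearly
  orthogonal to the point where it starts. Replacing that point by the \<open>j\<close>-th one costs at most the
  length of the window.
\<close>

lemma pair_step_le:
  assumes a: "1 \<le> a" "a + L \<le> k" and j: "j \<in> {a..a + L}" and v: "v \<in> step_set a L"
  shows "\<bar>pair j v\<bar> \<le> B * (real L * B\<^sup>2)"
proof -
  obtain i where i: "v = Y i - Y (i - 1)" "i \<in> {a + 1..a + L}" using v by (auto simp: step_set_def)
  define n where "n i = fst (Y i)" for i
  define p q where "p = Y i - Y j" and "q = Y (i - 1) - Y j"
  have L: "1 \<le> real L" using i by auto
  have B1: "1 \<le> B" using B_bounds(1) by simp
  have cone': "\<bar>(time i)\<^sup>2 - n i \<bullet> n i\<bar> < B" if "i \<in> {1..k}" for i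
    using cone[OF that] by (simp add: time_def n_def dot_square_norm)
  have "2 * pair j v = ((time i)\<^sup>2 - n i \<bullet> n i) - ((time (i - 1))\<^sup>2 - n (i - 1) \<bullet> n (i - 1))
      - (lam \<bullet> snd v) * (lam \<bullet> snd p + lam \<bullet> snd q) + fst v \<bullet> (fst p + fst q)"
    unfolding pair_def i(1) p_def q_def n_def time_def fst_diff snd_diff
      inner_diff_left inner_diff_right inner_add_left inner_add_right
    by (simp add: power2_eq_square inner_commute[of "fst (Y (i - Suc 0))" "fst (Y i)"]
        inner_commute[of "fst (Y j)" "fst (Y i)"] inner_commute[of "fst (Y j)" "fst (Y (i - Suc 0))"]
        algebra_simps)
  moreover have "\<bar>(lam \<bullet> snd v) * (lam \<bullet> snd p + lam \<bullet> snd q)\<bar> \<le> (\<Lambda> * B) * (\<Lambda> * (2 * (real L * B)))"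
    and "\<bar>fst v \<bullet> (fst p + fst q)\<bar> \<le> B * (2 * (real L * B))"
  proof -
    have pq: "norm p \<le> real L * B" "norm q \<le> real L * B"
      unfolding p_def q_def using i(2) by (auto intro!: window_distance[OF a _ j])
    have v': "norm v \<le> B" using step_bounds(2)[OF a v] .
    have comp: "norm (fst z) \<le> norm z" "norm (snd z) \<le> norm z" for z :: "(real ^ 'd) \<times> (real ^ 'b)"
      using norm_fst_le[of "fst z" "snd z"] norm_snd_le[of "snd z" "fst z"] by auto
    have "\<bar>lam \<bullet> snd v\<bar> \<le> \<Lambda> * B"
      using abs_lam_inner_le[of "snd v"] comp[of v] v' Lam_nonneg
      by (meson mult_left_mono order.trans)
    moreover have "\<bar>lam \<bullet> snd p + lam \<bullet> snd q\<bar> \<le> \<Lambda> * (2 * (real L * B))"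
    proof -
      have "\<bar>lam \<bullet> snd p\<bar> \<le> \<Lambda> * (real L * B)" "\<bar>lam \<bullet> snd q\<bar> \<le> \<Lambda> * (real L * B)"
        using abs_lam_inner_le comp pq Lam_nonneg by (meson mult_left_mono order.trans)+
      then show ?thesis by linarith
    qed
    ultimately show "\<bar>(lam \<bullet> snd v) * (lam \<bullet> snd p + lam \<bullet> snd q)\<bar> \<le> (\<Lambda> * B) * (\<Lambda> * (2 * (real L * B)))"
      unfolding abs_mult using Lam_nonneg B1 by (intro mult_mono) auto
    have "norm (fst p + fst q) \<le> 2 * (real L * B)"
      using norm_triangle_ineq[of "fst p" "fst q"] comp[of p] comp[of q] pq by linarith
    then have "norm (fst v) * norm (fst p + fst q) \<le> B * (2 * (real L * B))"
      using comp[of v] v' B1 by (intro mult_mono) auto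
    then show "\<bar>fst v \<bullet> (fst p + fst q)\<bar> \<le> B * (2 * (real L * B))"
      by (rule order.trans[OF Cauchy_Schwarz_ineq2])
  qed
  moreover have "\<bar>(time i)\<^sup>2 - n i \<bullet> n i\<bar> < B" "\<bar>(time (i - 1))\<^sup>2 - n (i - 1) \<bullet> n (i - 1)\<bar> < B"
    using i(2) a by (intro cone'; simp; linarith)+
  ultimately have "2 * \<bar>pair j v\<bar> \<le> 2 * B + (\<Lambda> * B) * (\<Lambda> * (2 * (real L * B))) + B * (2 * (real L * B))"
    by linarith
  then have "\<bar>pair j v\<bar> \<le> B + (\<Lambda>\<^sup>2 + 1) * (real L * B\<^sup>2)"
    by (simp add: power2_eq_square algebra_simps)
  also have "\<dots> \<le> real L * B\<^sup>2 + (\<Lambda>\<^sup>2 + 1) * (real L * B\<^sup>2)"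
    using L B1 mult_mono[of 1 "real L" B "B\<^sup>2"] self_le_power[of B 2] by simp
  also have "\<dots> = (2 + \<Lambda>\<^sup>2) * (real L * B\<^sup>2)"
    by (simp add: algebra_simps)
  also have "\<dots> \<le> B * (real L * B\<^sup>2)"
    using B_bounds(5) by (intro mult_right_mono) auto
  finally show ?thesis .
qed

end

section \<open>Windows of a chain\<close>

text \<open>
  The map \<open>u \<mapsto> (g \<bullet> u) g - u\<close> is minus the identity on the complement of \<open>g\<close> and multiplies
  \<open>g\<close> by \<open>|g|\<^sup>2 - 1\<close>, so it is boundedly invertible unless \<open>|g|\<close> is close to \<open>1\<close>.
\<close>

lemma graph_displacement_le:
  fixes g u :: "'a::real_inner"
  assumes g: "norm g \<le> G" "\<epsilon> \<le> \<bar>(norm g)\<^sup>2 - 1\<bar>" "0 < \<epsilon>" and q: "norm ((g \<bullet> u) *\<^sub>R g - u) \<le> Q"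
  shows "norm u \<le> Q * (G\<^sup>2 / \<epsilon> + 1)"
proof -
  let ?q = "(g \<bullet> u) *\<^sub>R g - u"
  have G: "0 \<le> G" using g(1) norm_ge_zero order.trans by blast
  have "g \<bullet> ?q = (g \<bullet> u) * ((norm g)\<^sup>2 - 1)"
    by (simp add: inner_diff_right power2_norm_eq_inner algebra_simps)
  then have "\<bar>g \<bullet> u\<bar> * \<bar>(norm g)\<^sup>2 - 1\<bar> \<le> norm g * norm ?q"
    using Cauchy_Schwarz_ineq2[of g ?q] by (simp add: abs_mult)
  also have "\<dots> \<le> G * Q" using g q G by (intro mult_mono) auto
  finally have "\<bar>g \<bullet> u\<bar> * \<epsilon> \<le> G * Q"
    using mult_left_mono[OF g(2), of "\<bar>g \<bullet> u\<bar>"] by simp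
  then have gu: "\<bar>g \<bullet> u\<bar> \<le> G * Q / \<epsilon>" using g(3) by (simp add: pos_le_divide_eq)
  have "norm u = norm ((g \<bullet> u) *\<^sub>R g - ?q)" by simp
  also have "\<dots> \<le> \<bar>g \<bullet> u\<bar> * norm g + norm ?q"
    using norm_triangle_ineq4[of "(g \<bullet> u) *\<^sub>R g" ?q] by simp
  also have "\<dots> \<le> (G * Q / \<epsilon>) * G + Q"
    using gu g(1) q by (intro add_mono mult_mono) auto
  finally show ?thesis by (simp add: power2_eq_square algebra_simps)
qed

context resonant_chain
begin

text \<open>
  The set \<open>S\<close> will be the span of the steps of a window. In the first case it contains a direction
  in which only the time coordinate moves; in the second case its image in \<open>\<real> \<times> \<real>\<^sup>d\<close> is the
  graph of the linear function \<open>w \<mapsto> g \<bullet> w\<close>. Both notions mention \<open>S\<close> only, not the frame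
  that produced the bounds, so that windows with the same span can be compared.
\<close>

definition vertical_window :: "nat \<Rightarrow> nat \<Rightarrow> ((real ^ 'd) \<times> (real ^ 'b)) set \<Rightarrow> bool" where
  "vertical_window j L S \<longleftrightarrow> (\<exists>\<kappa>. (0, \<kappa>) \<in> S \<and> B powr (- C') \<le> \<bar>lam \<bullet> \<kappa>\<bar>
     \<and> \<bar>pair j (0, \<kappa>)\<bar> \<le> R * (real L * B\<^sup>2))"

definition graph_window :: "nat \<Rightarrow> nat \<Rightarrow> ((real ^ 'd) \<times> (real ^ 'b)) set \<Rightarrow> bool" where
  "graph_window j L S \<longleftrightarrow> (\<exists>g \<in> fst ` S. norm g \<le> B * R
     \<and> B powr (- C') / R ^ (2 * CARD('d)) \<le> \<bar>(norm g)\<^sup>2 - 1\<bar>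
     \<and> (\<forall>z\<in>S. g \<bullet> fst z = lam \<bullet> snd z)
     \<and> (\<forall>z\<in>S. \<bar>pair j z\<bar> \<le> real CARD('d) * (R * (real L * B\<^sup>2)) * norm (fst z)))"

lemma pair_sum: "pair j (\<Sum>z\<in>Z. c z *\<^sub>R z) = (\<Sum>z\<in>Z. c z * pair j z)"
  by (simp add: pair_def fst_sum snd_sum inner_sum_right sum_distrib_left sum_subtractf algebra_simps)

text \<open>
  The vector \<open>g\<close> is the one whose inner products with the frame are prescribed by the lifts. The
  number \<open>|g|\<^sup>2 - 1\<close> cannot be small: after clearing denominators it is a quadratic polynomial in
  \<open>lam\<close> with constant term minus the product of the squared lengths of the frame, hence nonzero.
  This is the nondegeneracy of the indefinite form on the span of the steps.
\<close>

lemma frame_graph: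
  fixes Z :: "((real ^ 'd) \<times> (real ^ 'b)) set"
  assumes frame: "orthogonal_frame p R V Z" and p: "\<And>z. norm z \<le> p z"
  defines "g \<equiv> (\<Sum>z\<in>Z. (lam \<bullet> snd z / (fst z \<bullet> fst z)) *\<^sub>R fst z)"
  shows "g \<in> fst ` span V" "norm g \<le> B * R"
    "B powr (- C') / R ^ (2 * CARD('d)) \<le> \<bar>(norm g)\<^sup>2 - 1\<bar>"
    "\<And>w. w \<in> span Z \<Longrightarrow> g \<bullet> fst w = lam \<bullet> snd w"
proof -
  have fin: "finite Z" and ZV: "Z \<subseteq> span V"
    and Z: "\<And>z. z \<in> Z \<Longrightarrow> lattice_point z" "\<And>z. z \<in> Z \<Longrightarrow> fst z \<noteq> 0" "\<And>z. z \<in> Z \<Longrightarrow> p z \<le> R"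
    and orth: "\<And>z z'. z \<in> Z \<Longrightarrow> z' \<in> Z \<Longrightarrow> z \<noteq> z' \<Longrightarrow> fst z \<bullet> fst z' = 0"
    using frame by (auto simp: orthogonal_frame_def)
  have card_le: "card Z \<le> CARD('d)" by (rule orthogonal_frame_card_le[OF frame])
  have snd_le: "norm (snd z) \<le> R" if "z \<in> Z" for z
    using norm_snd_le[of "snd z" "fst z"] p[of z] Z(3)[OF that] by simp
  have N1: "1 \<le> fst z \<bullet> fst z" if "z \<in> Z" for z
    using Z[OF that] by (simp add: lattice_point_def one_le_inner_int_vec)
  define c where "c z = lam \<bullet> snd z / (fst z \<bullet> fst z)" for z :: "(real ^ 'd) \<times> (real ^ 'b)"
  have "g = fst (\<Sum>z\<in>Z. c z *\<^sub>R z)" by (simp add: g_def c_def fst_sum)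
  moreover have "(\<Sum>z\<in>Z. c z *\<^sub>R z) \<in> span V"
    using ZV by (intro span_sum span_scale) auto
  ultimately show "g \<in> fst ` span V" by blast
  have g_frame: "g \<bullet> fst w = lam \<bullet> snd w" if "w \<in> Z" for w
  proof -
    have "g \<bullet> fst w = (\<Sum>z\<in>Z. c z * (fst z \<bullet> fst w))" by (simp add: g_def c_def inner_sum_left)
    also have "\<dots> = c w * (fst w \<bullet> fst w)"
      using orth that by (intro inner_scaleR_unfold_sum[OF fin]) auto
    finally show ?thesis using N1[OF that] Z(2)[OF that] by (simp add: c_def)
  qed
  show "g \<bullet> fst w = lam \<bullet> snd w" if "w \<in> span Z" for w
    using that
  proof (induction rule: span_induct_alt)
    case base then show ?case by simp
  next
    case (step a x y) then show ?case by (simp add: g_frame inner_add_right)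
  qed
  have "norm g \<le> (\<Sum>z\<in>Z. norm ((lam \<bullet> snd z / (fst z \<bullet> fst z)) *\<^sub>R fst z))"
    unfolding g_def by (rule norm_sum)
  also have "\<dots> \<le> (\<Sum>z\<in>Z. \<Lambda> * R)"
  proof (intro sum_mono)
    fix z assume z: "z \<in> Z"
    have N: "1 \<le> norm (fst z)" using N1[OF z] by (simp add: norm_eq_sqrt_inner)
    have "norm ((lam \<bullet> snd z / (fst z \<bullet> fst z)) *\<^sub>R fst z) = \<bar>lam \<bullet> snd z\<bar> / norm (fst z)"
      using N by (auto simp: dot_square_norm power2_eq_square divide_simps)
    also have "\<dots> \<le> \<bar>lam \<bullet> snd z\<bar>" using N by (simp add: divide_le_eq mult_le_cancel_left1)
    also have "\<dots> \<le> \<Lambda> * R"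
      using abs_lam_inner_le[of "snd z"] snd_le[OF z] Lam_nonneg
      by (meson mult_left_mono order.trans)
    finally show "norm ((lam \<bullet> snd z / (fst z \<bullet> fst z)) *\<^sub>R fst z) \<le> \<Lambda> * R" .
  qed
  also have "\<dots> \<le> real CARD('d) * (\<Lambda> * R)"
    using card_le Lam_nonneg R_ge by (simp add: mult_right_mono)
  also have "\<dots> \<le> B * R"
    using B_bounds(6) R_ge mult_right_mono[of "real CARD('d) * \<Lambda>" B R] by (simp add: mult_ac)
  finally show "norm g \<le> B * R" .
  define N where "N z = fst z \<bullet> fst z" for z :: "(real ^ 'd) \<times> (real ^ 'b)"
  define D where "D = prod N Z"
  define D' where "D' z = prod N (Z - {z})" for z
  note prod = orthogonal_frame_prod[OF frame p R_ge, folded N_def]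
  have D: "D \<in> \<int>" "1 \<le> D" "D \<le> R ^ (2 * CARD('d))"
    using prod[of Z] by (simp_all add: D_def)
  have D': "D' z \<in> \<int>" "1 \<le> D' z" "D' z \<le> R ^ (2 * CARD('d))" for z
    using prod[of "Z - {z}"] by (simp_all add: D'_def)
  have split: "D = N z * D' z" if "z \<in> Z" for z
    unfolding D_def D'_def using fin that by (rule prod.remove)
  have "g \<bullet> g = (\<Sum>z\<in>Z. c z * (g \<bullet> fst z))"
    by (subst (2) g_def) (simp add: c_def inner_sum_right)
  then have "D * (g \<bullet> g) = (\<Sum>z\<in>Z. D * (c z * (lam \<bullet> snd z)))"
    by (simp add: g_frame sum_distrib_left)
  also have "\<dots> = (\<Sum>z\<in>Z. D' z * (lam \<bullet> snd z)\<^sup>2)"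
  proof (intro sum.cong refl)
    fix z assume z: "z \<in> Z"
    show "D * (c z * (lam \<bullet> snd z)) = D' z * (lam \<bullet> snd z)\<^sup>2"
      using N1[OF z] Z(2)[OF z] by (simp add: split[OF z] c_def N_def power2_eq_square)
  qed
  finally have "D * ((norm g)\<^sup>2 - 1) = - D + (\<Sum>z\<in>Z. D' z * (lam \<bullet> snd z)\<^sup>2)"
    by (simp add: power2_norm_eq_inner algebra_simps)
  moreover have "\<bar>- D + (\<Sum>z\<in>Z. D' z * (lam \<bullet> snd z)\<^sup>2)\<bar> > B powr (- C')"
  proof (rule quadratic_lower_bound[OF fin card_le])
    show "0 < D' z" for z using D'(2)[of z] by linarith
    show "- D \<noteq> 0 \<or> (\<exists>z\<in>Z. snd z \<noteq> 0)" using D(2) by simp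
  qed (use D D' Z(1) snd_le in \<open>auto simp: lattice_point_def\<close>)
  ultimately have "B powr (- C') \<le> D * \<bar>(norm g)\<^sup>2 - 1\<bar>"
    using D(2) by (metis abs_mult abs_of_nonneg less_imp_le order.trans zero_le_one)
  also have "\<dots> \<le> R ^ (2 * CARD('d)) * \<bar>(norm g)\<^sup>2 - 1\<bar>"
    using D(3) by (intro mult_right_mono) auto
  finally show "B powr (- C') / R ^ (2 * CARD('d)) \<le> \<bar>(norm g)\<^sup>2 - 1\<bar>"
    using R_ge by (simp add: divide_le_eq mult.commute)
qed

lemma frame_pair_le:
  fixes Z :: "((real ^ 'd) \<times> (real ^ 'b)) set"
  assumes frame: "orthogonal_frame p R V Z"
    and pairs: "\<And>z. z \<in> Z \<Longrightarrow> \<bar>pair j z\<bar> \<le> T" and w: "w \<in> span Z" and "0 \<le> T"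
  shows "\<bar>pair j w\<bar> \<le> real CARD('d) * T * norm (fst w)"
proof -
  define c where "c z = fst w \<bullet> fst z / (fst z \<bullet> fst z)" for z :: "(real ^ 'd) \<times> (real ^ 'b)"
  have "w = (\<Sum>z\<in>Z. c z *\<^sub>R z)"
    unfolding c_def by (rule orthogonal_frame_expansion[OF frame w])
  then have "pair j w = (\<Sum>z\<in>Z. c z * pair j z)" using pair_sum[of j c Z] by simp
  also have "\<bar>\<dots>\<bar> \<le> (\<Sum>z\<in>Z. \<bar>c z * pair j z\<bar>)" by (rule sum_abs)
  also have "\<dots> \<le> (\<Sum>z\<in>Z. norm (fst w) * T)"
  proof (intro sum_mono)
    fix z assume z: "z \<in> Z"
    have z': "1 \<le> fst z \<bullet> fst z"
      using frame z by (auto simp: orthogonal_frame_def lattice_point_def intro: one_le_inner_int_vec)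
    then have N: "1 \<le> norm (fst z)" by (simp add: norm_eq_sqrt_inner)
    have "\<bar>c z\<bar> \<le> norm (fst w) * norm (fst z) / (norm (fst z))\<^sup>2"
      unfolding c_def abs_divide using Cauchy_Schwarz_ineq2[of "fst w" "fst z"]
      by (simp add: dot_square_norm divide_right_mono)
    also have "\<dots> = norm (fst w) / norm (fst z)" using N by (simp add: power2_eq_square)
    also have "\<dots> \<le> norm (fst w)" using N by (simp add: divide_le_eq mult_le_cancel_left1)
    finally show "\<bar>c z * pair j z\<bar> \<le> norm (fst w) * T"
      unfolding abs_mult using pairs[OF z] by (intro mult_mono) auto
  qed
  also have "\<dots> \<le> real CARD('d) * (norm (fst w) * T)"
    using orthogonal_frame_card_le[OF frame] assms(4) by (simp add: mult_right_mono)
  finally show ?thesis by (simp add: mult_ac)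
qed

text \<open>
  The frame is built with a seminorm that measures at once the length of a vector and its
  pairing with the \<open>j\<close>-th point, so that every bounded integral combination of steps stays short and
  nearly orthogonal to that point.
\<close>

lemma window_dichotomy:
  assumes a: "1 \<le> a" "a + L \<le> k" and L: "1 \<le> L" and j: "j \<in> {a..a + L}"
  shows "vertical_window j L (span (step_set a L)) \<or> graph_window j L (span (step_set a L))"
proof -
  define T where "T = real L * B\<^sup>2"
  have T: "0 < T" using L B_bounds(1) by (simp add: T_def)
  \<comment> \<open>Since \<open>T\<close> is the bound for the pairing of a step divided by \<open>B\<close>, each step has \<open>p\<close> at most \<open>B\<close>.\<close>
  define p where "p z = max (norm z) (\<bar>pair j z\<bar> / T)" for z
  have p_norm: "norm z \<le> p z" for z by (simp add: p_def)
  have p_pair: "\<bar>pair j z\<bar> \<le> r * T" if "p z \<le> r" for r z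
    using that T by (simp add: p_def pos_divide_le_eq)
  have p_scale: "p (c *\<^sub>R z) \<le> \<bar>c\<bar> * p z" for c z
  proof -
    have "pair j (c *\<^sub>R z) = c * pair j z" by (simp add: pair_def algebra_simps)
    then have "\<bar>pair j (c *\<^sub>R z)\<bar> / T = \<bar>c\<bar> * (\<bar>pair j z\<bar> / T)" by (simp add: abs_mult)
    moreover have "norm (c *\<^sub>R z) = \<bar>c\<bar> * norm z" by simp
    moreover have "\<bar>c\<bar> * norm z \<le> \<bar>c\<bar> * p z" "\<bar>c\<bar> * (\<bar>pair j z\<bar> / T) \<le> \<bar>c\<bar> * p z"
      by (simp_all only: p_def mult_left_mono max.cobounded1 max.cobounded2 abs_ge_zero)
    ultimately show ?thesis unfolding p_def[of "c *\<^sub>R z"] by (metis max.boundedI)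
  qed
  have p_add: "p (y + z) \<le> p y + p z" for y z
  proof -
    have "pair j (y + z) = pair j y + pair j z" by (simp add: pair_def inner_add_right algebra_simps)
    then have "\<bar>pair j (y + z)\<bar> / T \<le> \<bar>pair j y\<bar> / T + \<bar>pair j z\<bar> / T"
      using T by (simp add: divide_right_mono flip: add_divide_distrib)
    then show ?thesis unfolding p_def using norm_triangle_ineq[of y z] by linarith
  qed
  have p_step: "p v \<le> B" if "v \<in> step_set a L" for v
    using step_bounds(2)[OF a that] pair_step_le[OF a j that] T
    by (simp add: p_def T_def pos_divide_le_eq)
  have "(\<exists>\<zeta>\<in>span (step_set a L). lattice_point \<zeta> \<and> fst \<zeta> = 0 \<and> snd \<zeta> \<noteq> 0 \<and> p \<zeta> \<le> R)
      \<or> (\<exists>Z. orthogonal_frame p R (step_set a L) Z \<and> step_set a L \<subseteq> span Z)"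
    unfolding R_def
    by (rule orthogonal_frame_dichotomy[OF p_scale p_add p_norm step_bounds(1)[OF a] p_step B_bounds(2)])
  then show ?thesis
  proof (elim disjE bexE exE conjE)
    fix \<zeta> assume \<zeta>: "\<zeta> \<in> span (step_set a L)" "lattice_point \<zeta>" "fst \<zeta> = 0" "snd \<zeta> \<noteq> 0" "p \<zeta> \<le> R"
    have eq: "\<zeta> = (0, snd \<zeta>)" using \<zeta>(3) by (metis prod.collapse)
    have "norm (snd \<zeta>) \<le> R"
      using norm_snd_le[of "snd \<zeta>" "fst \<zeta>"] p_norm[of \<zeta>] \<zeta>(5) by simp
    then have "B powr (- C') \<le> \<bar>lam \<bullet> snd \<zeta>\<bar>"
      using \<zeta> by (intro linear_lower_bound) (auto simp: lattice_point_def)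
    then show ?thesis
      using \<zeta>(1) p_pair[OF \<zeta>(5)] eq unfolding vertical_window_def T_def by metis
  next
    fix Z assume Z: "orthogonal_frame p R (step_set a L) Z" "step_set a L \<subseteq> span Z"
    have sub: "span (step_set a L) \<subseteq> span Z" using Z(2) by (simp add: span_minimal)
    have "\<bar>pair j z\<bar> \<le> R * T" if "z \<in> Z" for z
      using Z(1) that p_pair by (auto simp: orthogonal_frame_def)
    then have "\<bar>pair j w\<bar> \<le> real CARD('d) * (R * T) * norm (fst w)" if "w \<in> span (step_set a L)" for w
      by (rule frame_pair_le[OF Z(1)]) (use sub that T R_ge \<open>\<And>z. z \<in> Z \<Longrightarrow> \<bar>pair j z\<bar> \<le> R * T\<close> in auto)
    then have "graph_window j L (span (step_set a L))"
      using frame_graph[OF Z(1) p_norm] sub unfolding graph_window_def T_def by blast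
    then show ?thesis by blast
  qed
qed

end

section \<open>Counting and the growth of the exponents\<close>

lemma card_int_vec_ball_le:
  fixes A :: "(real ^ 'd::finite) set"
  assumes A: "\<And>n. n \<in> A \<Longrightarrow> int_vec n" "\<And>n. n \<in> A \<Longrightarrow> norm (n - c) \<le> M" and c: "int_vec c" and M: "0 \<le> M"
  shows "real (card A) \<le> (2 * M + 1) ^ CARD('d)"
proof -
  define f where "f n = (\<lambda>i. \<lfloor>(n - c) $ i\<rfloor>)" for n :: "real ^ 'd"
  let ?box = "PiE (UNIV :: 'd set) (\<lambda>_. {-\<lfloor>M\<rfloor>..\<lfloor>M\<rfloor>})"
  have f: "real_of_int (f n i) = (n - c) $ i" if "n \<in> A" for n i
  proof -
    have "(n - c) $ i \<in> \<int>" using A(1)[OF that] c by (simp add: int_vec_def)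
    then obtain m :: int where "(n - c) $ i = of_int m" by (rule Ints_cases)
    then show ?thesis by (simp only: f_def floor_of_int)
  qed
  have "inj_on f A"
  proof (rule inj_onI)
    fix x y assume xy: "x \<in> A" "y \<in> A" "f x = f y"
    then have "(x - c) $ i = (y - c) $ i" for i using f[of x i] f[of y i] by simp
    then show "x = y" by (simp add: vec_eq_iff)
  qed
  moreover have "f ` A \<subseteq> ?box"
  proof -
    have "f n i \<in> {-\<lfloor>M\<rfloor>..\<lfloor>M\<rfloor>}" if "n \<in> A" for n i
    proof -
      have "\<bar>real_of_int (f n i)\<bar> \<le> M"
        using f[OF that, of i] component_le_norm_cart[of "n - c" i] A(2)[OF that] by simp
      then show ?thesis by (simp add: abs_le_iff le_floor_iff minus_le_iff[of "\<lfloor>M\<rfloor>"])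
    qed
    then show ?thesis by auto
  qed
  moreover have "finite ?box" by (intro finite_PiE) auto
  ultimately have "card A \<le> card ?box" by (rule card_inj_on_le)
  also have "card ?box = nat (2 * \<lfloor>M\<rfloor> + 1) ^ CARD('d)" by (simp add: card_PiE)
  finally have "real (card A) \<le> real (nat (2 * \<lfloor>M\<rfloor> + 1)) ^ CARD('d)"
    by (metis of_nat_le_iff of_nat_power)
  also have "\<dots> \<le> (2 * M + 1) ^ CARD('d)"
    using M by (intro power_mono) auto
  finally show ?thesis .
qed

text \<open>
  Passing from dimension \<open>t\<close> to \<open>t + 1\<close> replaces a length \<open>L\<close> by the number of lattice points in
  a ball of radius about \<open>L * B powr c\<close>, times the multiplicity of a point.
\<close>

primrec chain_exponent :: "real \<Rightarrow> real \<Rightarrow> nat \<Rightarrow> real" where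
  "chain_exponent d c 0 = 0"
| "chain_exponent d c (Suc t) = 1 + d * (chain_exponent d c t + c + 1)"

lemma chain_exponent_nonneg: "0 \<le> d \<Longrightarrow> 0 \<le> c \<Longrightarrow> 0 \<le> chain_exponent d c t"
  by (induction t) auto

lemma chain_exponent_mono: "1 \<le> d \<Longrightarrow> 0 \<le> c \<Longrightarrow> chain_exponent d c t \<le> chain_exponent d c (Suc t)"
proof -
  assume dc: "1 \<le> d" "0 \<le> c"
  have e: "0 \<le> chain_exponent d c t" using dc by (intro chain_exponent_nonneg) auto
  have "1 * (chain_exponent d c t + c + 1) \<le> d * (chain_exponent d c t + c + 1)"
    using dc e by (intro mult_right_mono) auto
  then show ?thesis using dc by simp
qed

section \<open>Induction on the dimension spanned by the steps\<close>

context resonant_chain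
begin

lemma chain_difference_in_span:
  assumes "i \<in> {s..s + N}" "j \<in> {s..s + N}"
  shows "Y i - Y j \<in> span (step_set s N)"
proof -
  have base: "Y (s + m) - Y s \<in> span (step_set s N)" if "m \<le> N" for m
    using that
  proof (induction m)
    case (Suc m)
    have "Y (s + Suc m) - Y (s + Suc m - 1) \<in> step_set s N"
      unfolding step_set_def using Suc by (intro imageI) auto
    then have "(Y (s + Suc m) - Y (s + m)) + (Y (s + m) - Y s) \<in> span (step_set s N)"
      using Suc by (intro span_add) (auto intro: span_base)
    then show ?case by simp
  qed (simp add: span_zero)
  have "(Y (s + (i - s)) - Y s) - (Y (s + (j - s)) - Y s) \<in> span (step_set s N)"
    using assms by (intro span_diff base) auto
  then show ?thesis using assms by simp
qed

text \<open>
  The radius, per unit of window length, of the ball that contains the positions visited by a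
  chain whose windows all span the same space.
\<close>

definition reach :: real where
  "reach = R ^ (2 * CARD('d) + 3) * B ^ 5 * B powr C'"

lemma norm_fst_le_time:
  assumes "j \<in> {1..k}"
  shows "norm (fst (Y j)) \<le> \<bar>time j\<bar> + B"
proof (rule power2_le_imp_le)
  have "(norm (fst (Y j)))\<^sup>2 \<le> (time j)\<^sup>2 + B"
    using cone[OF assms] unfolding time_def by linarith
  also have "\<dots> \<le> \<bar>time j\<bar>\<^sup>2 + B\<^sup>2"
    using B_bounds(1) self_le_power[of B 2] by simp
  also have "\<dots> \<le> (\<bar>time j\<bar> + B)\<^sup>2"
    using B_bounds(1) by (simp add: power2_sum)
  finally show "(norm (fst (Y j)))\<^sup>2 \<le> (\<bar>time j\<bar> + B)\<^sup>2" .
qed (use B_bounds(1) in simp)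

text \<open>
  If some window is vertical, then so are all, because a vertical direction in the common span
  excludes a graph; the time coordinate of each point is then bounded, and with it the position.
  Otherwise the span is a graph given by one vector \<open>g\<close>, and the vectors
  \<open>time l *\<^sub>R g - fst (Y l)\<close> represent the pairings with the points on the span. The difference
  of two of them is \<open>(g \<bullet> u) g - u\<close> for the displacement \<open>u\<close>. It lies in the
  projection of the span to \<open>\<real>\<^sup>d\<close>, so its inner product with itself is a difference of two bounded
  pairings. This bounds it, and then \<open>u\<close>.
\<close>

lemma displacement_le:
  assumes s: "1 \<le> s" "s + N \<le> k" and L: "1 \<le> L" "L \<le> N"
    and windows: "\<And>a. s \<le> a \<Longrightarrow> a + L \<le> s + N \<Longrightarrow> span (step_set a L) = span (step_set s N)"
    and ij: "i \<in> {s..s + N}" "j \<in> {s..s + N}"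
  shows "norm (fst (Y i) - fst (Y j)) \<le> real L * reach"
proof -
  define S where "S = span (step_set s N)"
  define T where "T = R * (real L * B\<^sup>2)"
  define P where "P = B powr C'"
  have P: "1 \<le> P" "B powr (- C') = 1 / P"
    using B_bounds(1) C'_nonneg by (simp_all add: P_def ge_one_powr_ge_zero powr_minus_divide)
  have B1: "1 \<le> B" "4 \<le> B" using B_bounds(1) by auto
  have T: "B \<le> T"
  proof -
    have "1 * (1 * B) \<le> R * (real L * B\<^sup>2)"
      using R_ge L(1) B1 self_le_power[of B 2] by (intro mult_mono) auto
    then show ?thesis by (simp add: T_def)
  qed
  have dich: "vertical_window l L S \<or> graph_window l L S" if "l \<in> {s..s + N}" for l
  proof -
    \<comment> \<open>a window of \<open>L\<close> steps inside the interval that contains \<open>l\<close>\<close>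
    define a where "a = min l (s + N - L)"
    have a: "s \<le> a" "a + L \<le> s + N" "l \<in> {a..a + L}" using that L by (auto simp: a_def)
    then show ?thesis
      using window_dichotomy[of a L l] windows[of a] s L by (simp add: S_def)
  qed
  show ?thesis
  proof (cases "\<exists>l \<in> {s..s + N}. vertical_window l L S")
    case True
    then obtain \<kappa> where \<kappa>: "(0, \<kappa>) \<in> S" "B powr (- C') \<le> \<bar>lam \<bullet> \<kappa>\<bar>"
      unfolding vertical_window_def by blast
    then have "lam \<bullet> \<kappa> \<noteq> 0" using P by (auto simp: divide_le_eq)
    have near: "norm (fst (Y l)) \<le> T * P + B" if l: "l \<in> {s..s + N}" for l
    proof -
      have "vertical_window l L S"
      proof (rule ccontr)
        assume "\<not> vertical_window l L S"
        then obtain g where "\<forall>z\<in>S. g \<bullet> fst z = lam \<bullet> snd z"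
          using dich[OF l] unfolding graph_window_def by blast
        then show False using \<kappa>(1) \<open>lam \<bullet> \<kappa> \<noteq> 0\<close> by fastforce
      qed
      then obtain \<kappa>' where \<kappa>': "1 / P \<le> \<bar>lam \<bullet> \<kappa>'\<bar>" "\<bar>time l\<bar> * \<bar>lam \<bullet> \<kappa>'\<bar> \<le> T"
        unfolding vertical_window_def P T_def by (auto simp: pair_def abs_mult)
      have "\<bar>time l\<bar> * (1 / P) \<le> T"
        using mult_left_mono[OF \<kappa>'(1), of "\<bar>time l\<bar>"] \<kappa>'(2) by simp
      then have "\<bar>time l\<bar> \<le> T * P" using P by (simp add: divide_le_eq)
      then show ?thesis using norm_fst_le_time[of l] l s by auto
    qed
    have "norm (fst (Y i) - fst (Y j)) \<le> (T * P + B) + (T * P + B)"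
      by (intro order.trans[OF norm_triangle_ineq4] add_mono near ij)
    also have "\<dots> \<le> 4 * (T * P)"
      using T P B1 mult_mono[of B T 1 P] by (simp add: mult.commute)
    also have "\<dots> \<le> B * (T * P)" using B1 T P by (intro mult_right_mono) auto
    also have "\<dots> = real L * (R ^ 1 * B ^ 3 * P)"
      by (simp add: T_def power2_eq_square power3_eq_cube)
    also have "\<dots> \<le> real L * (R ^ (2 * CARD('d) + 3) * B ^ 5 * P)"
      using R_ge B1 P by (intro mult_left_mono mult_right_mono mult_mono power_increasing) auto
    finally show ?thesis by (simp add: reach_def P_def)
  next
    case False
    then have graph: "graph_window l L S" if "l \<in> {s..s + N}" for l using dich that by blast
    let ?Q = "2 * (real CARD('d) * T)"
    obtain g where g: "g \<in> fst ` S" "norm g \<le> B * R" "(1 / P) / R ^ (2 * CARD('d)) \<le> \<bar>(norm g)\<^sup>2 - 1\<bar>"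
      "\<And>z. z \<in> S \<Longrightarrow> g \<bullet> fst z = lam \<bullet> snd z"
      using graph[OF ij(1)] unfolding graph_window_def P by blast
    obtain zg where zg: "zg \<in> S" "g = fst zg" using g(1) by blast
    define u where "u = fst (Y i) - fst (Y j)"
    define z where "z = (g \<bullet> u) *\<^sub>R zg - (Y i - Y j)"
    have uS: "Y i - Y j \<in> S" unfolding S_def by (rule chain_difference_in_span[OF ij])
    then have zS: "z \<in> S"
      using span_diff[OF span_scale[OF zg(1)[unfolded S_def]] uS[unfolded S_def]]
      by (simp add: z_def S_def)
    have q: "fst z = (g \<bullet> u) *\<^sub>R g - u" by (simp add: z_def zg(2) u_def)
    have time_diff: "time i - time j = g \<bullet> u"
      using g(4)[OF uS] by (simp add: time_def u_def inner_diff_right)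
    have pair_z: "pair l z = (time l *\<^sub>R g - fst (Y l)) \<bullet> fst z" for l
      using g(4)[OF zS] by (simp add: pair_def inner_diff_left)
    have "pair i z - pair j z = ((time i - time j) *\<^sub>R g - u) \<bullet> fst z"
      unfolding pair_z by (simp add: u_def inner_diff_left algebra_simps)
    then have "pair i z - pair j z = fst z \<bullet> fst z" by (simp only: time_diff q)
    then have "norm (fst z) * norm (fst z) \<le> \<bar>pair i z\<bar> + \<bar>pair j z\<bar>"
      by (simp add: dot_square_norm power2_eq_square)
    also have "\<dots> \<le> real CARD('d) * T * norm (fst z) + real CARD('d) * T * norm (fst z)"
      using graph[OF ij(1)] graph[OF ij(2)] zS unfolding graph_window_def T_def
      by (intro add_mono) blast+
    finally have "norm (fst z) * norm (fst z) \<le> ?Q * norm (fst z)" by (simp add: mult_ac)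
    then have "norm (fst z) \<le> ?Q"
      using T B1 by (cases "norm (fst z) = 0") (auto simp: mult_le_cancel_right)
    then have "norm u \<le> ?Q * ((B * R)\<^sup>2 / ((1 / P) / R ^ (2 * CARD('d))) + 1)"
      using P R_ge unfolding q by (intro graph_displacement_le[OF g(2,3)]) auto
    also have "\<dots> = ?Q * (B ^ 2 * R ^ (2 * CARD('d) + 2) * P + 1)"
      by (simp add: power_mult_distrib power_add mult_ac power2_eq_square)
    also have "\<dots> \<le> ?Q * (2 * (B ^ 2 * R ^ (2 * CARD('d) + 2) * P))"
    proof -
      have "1 * 1 * 1 \<le> B ^ 2 * R ^ (2 * CARD('d) + 2) * P"
        using B1 R_ge P by (intro mult_mono one_le_power) auto
      then have "B ^ 2 * R ^ (2 * CARD('d) + 2) * P + 1 \<le> 2 * (B ^ 2 * R ^ (2 * CARD('d) + 2) * P)"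
        unfolding mult_2 mult_1 by (rule add_left_mono)
      moreover have "0 \<le> ?Q" using T B1 by simp
      ultimately show ?thesis by (rule mult_left_mono)
    qed
    also have "\<dots> = (4 * real CARD('d)) * (T * (B ^ 2 * R ^ (2 * CARD('d) + 2) * P))" by simp
    also have "\<dots> \<le> B * (T * (B ^ 2 * R ^ (2 * CARD('d) + 2) * P))"
      using B_bounds(3) T B1 R_ge P by (intro mult_right_mono) auto
    also have "\<dots> = real L * reach"
      by (simp add: T_def reach_def P_def power_add power2_eq_square numeral_eq_Suc mult_ac)
    finally show ?thesis by (simp add: u_def)
  qed
qed

lemma reach_powr:
  "reach = B powr (real (frame_exponent CARD('d) * (2 * CARD('d) + 3) + 5) + C')"
proof -
  have "reach = B ^ (frame_exponent CARD('d) * (2 * CARD('d) + 3) + 5) * B powr C'"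
    unfolding reach_def R_def power_mult[symmetric] power_add[symmetric] ..
  also have "B ^ (frame_exponent CARD('d) * (2 * CARD('d) + 3) + 5)
      = B powr real (frame_exponent CARD('d) * (2 * CARD('d) + 3) + 5)"
    using B_bounds(1) by (intro powr_realpow[symmetric]) auto
  finally show ?thesis by (simp add: powr_add)
qed

text \<open>
  Choose \<open>L\<close> so that \<open>L + 1\<close> points just exceed the bound for dimension \<open>t\<close>. Every window of
  \<open>L\<close> steps then spans more than \<open>t\<close> dimensions, hence as much as the whole chain if that spans
  only \<open>t + 1\<close>. So all positions lie in one ball, and each is visited at most \<open>B'\<close> times. A chain with a step spans at least one dimension
  because its points are distinct.
\<close>

lemma chain_length_le:
  assumes mult: "\<And>n. real (card {j \<in> {1..k}. fst (Y j) = n}) \<le> B'" and B': "1 \<le> B'"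
  defines "c \<equiv> real (frame_exponent CARD('d) * (2 * CARD('d) + 3) + 5) + C'"
  assumes "1 \<le> s" "s + N \<le> k" "dim (step_set s N) \<le> t"
  shows "real (N + 1) \<le> (B * B') powr chain_exponent CARD('d) c t"
  using assms(4-)
proof (induction t arbitrary: s N)
  case 0
  have "N = 0"
  proof (rule ccontr)
    assume "N \<noteq> 0"
    then have v: "Y (s + 1) - Y (s + 1 - 1) \<in> step_set s N"
      unfolding step_set_def by (intro imageI) auto
    then have "Y (s + 1) - Y (s + 1 - 1) = 0" using 0(3) by (auto simp: dim_eq_0)
    then show False using step_bounds(3)[OF 0(1,2) v] by blast
  qed
  moreover have "1 \<le> B * B'" using B' B_bounds(1) by (intro mult_ge1_I) auto
  ultimately show ?case by auto
next
  case (Suc t)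
  let ?X = "B * B'" and ?\<gamma> = "chain_exponent CARD('d) c t"
  have c: "0 \<le> c" unfolding c_def using C'_nonneg by simp
  have d: "1 \<le> real CARD('d)" by simp
  have X: "B \<le> ?X" "1 \<le> ?X" "B' \<le> ?X"
  proof -
    have "B * 1 \<le> B * B'" "1 * B' \<le> B * B'"
      using B' B_bounds(1) by (intro mult_left_mono mult_right_mono; simp)+
    then show "B \<le> ?X" "1 \<le> ?X" "B' \<le> ?X" using B_bounds(1) by linarith+
  qed
  have X0: "?X \<noteq> 0" using X by linarith
  have \<gamma>: "0 \<le> ?\<gamma>" using chain_exponent_nonneg[of "real CARD('d)"] c by simp
  \<comment> \<open>the least length to which the bound for dimension \<open>t\<close> does not apply\<close>
  define L where "L = nat \<lfloor>?X powr ?\<gamma>\<rfloor>"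
  have "1 \<le> ?X powr ?\<gamma>" using X \<gamma> by (simp add: ge_one_powr_ge_zero)
  then have L: "1 \<le> L" "real L \<le> ?X powr ?\<gamma>" "?X powr ?\<gamma> < real (L + 1)"
    unfolding L_def by linarith+
  show ?case
  proof (cases "N < L")
    case True
    then have "real (N + 1) \<le> ?X powr ?\<gamma>" using L by linarith
    also have "\<dots> \<le> ?X powr chain_exponent CARD('d) c (Suc t)"
      using X chain_exponent_mono[OF d c] by (intro powr_mono) auto
    finally show ?thesis .
  next
    case False
    have windows: "span (step_set a L) = span (step_set s N)" if "s \<le> a" "a + L \<le> s + N" for a
    proof -
      have "step_set a L \<subseteq> step_set s N"
        unfolding step_set_def using that by (intro image_mono) auto
      moreover have "\<not> dim (step_set a L) \<le> t"
        using Suc.IH[of a L] Suc.prems that L(3) by auto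
      ultimately show ?thesis using Suc.prems(3) by (intro dim_eq_span) auto
    qed
    let ?I = "{s..s + N}" and ?M = "real L * reach"
    have I: "?I \<subseteq> {1..k}" using Suc.prems by auto
    have disp: "norm (fst (Y i) - fst (Y s)) \<le> ?M" if "i \<in> ?I" for i
      using displacement_le[OF Suc.prems(1,2) L(1) _ windows that] False by simp
    have int: "int_vec (fst (Y i))" if "i \<in> ?I" for i
      using lattice[of i] that I by (auto simp: lattice_point_def)
    have reach: "1 \<le> reach"
      unfolding reach_powr c_def[symmetric] using B_bounds(1) c by (intro ge_one_powr_ge_zero) auto
    have M1: "1 \<le> ?M" using L(1) reach mult_mono[of 1 "real L" 1 reach] by simp
    have "card ((\<lambda>i. fst (Y i)) ` ?I) \<le> (2 * ?M + 1) ^ CARD('d)"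
      using disp int M1 by (intro card_int_vec_ball_le[where c = "fst (Y s)"]) auto
    also have "\<dots> \<le> (?X powr (?\<gamma> + c + 1)) ^ CARD('d)"
    proof (intro power_mono)
      have "2 * ?M + 1 \<le> B * ?M" using M1 B_bounds(1) mult_right_mono[of 5 B ?M] by linarith
      also have "\<dots> = real L * (B powr c * B powr 1)"
        using B_bounds(1) by (simp add: reach_powr c_def mult_ac)
      also have "\<dots> \<le> ?X powr ?\<gamma> * (?X powr c * ?X powr 1)"
        using L X c B_bounds(1) by (intro mult_mono powr_mono2) auto
      finally show "2 * ?M + 1 \<le> ?X powr (?\<gamma> + c + 1)" by (simp add: powr_add mult_ac)
    qed (use M1 in auto)
    finally have distinct_places: "real (card ((\<lambda>i. fst (Y i)) ` ?I)) \<le> ?X powr (real CARD('d) * (?\<gamma> + c + 1))"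
      by (simp only: powr_power[OF X0])
    have "card ?I = (\<Sum>n\<in>(\<lambda>i. fst (Y i)) ` ?I. card {i \<in> ?I. fst (Y i) = n})"
      unfolding card_eq_sum by (rule sum.image_gen) simp
    then have "real (N + 1) = (\<Sum>n\<in>(\<lambda>i. fst (Y i)) ` ?I. real (card {i \<in> ?I. fst (Y i) = n}))"
      by simp
    also have "\<dots> \<le> (\<Sum>n\<in>(\<lambda>i. fst (Y i)) ` ?I. B')"
    proof (intro sum_mono)
      fix n
      have "card {i \<in> ?I. fst (Y i) = n} \<le> card {j \<in> {1..k}. fst (Y j) = n}"
        using I by (intro card_mono) auto
      then show "real (card {i \<in> ?I. fst (Y i) = n}) \<le> B'" using mult[of n] by linarith
    qed
    also have "\<dots> \<le> ?X powr (real CARD('d) * (?\<gamma> + c + 1)) * ?X powr 1"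
      using distinct_places B' X by (simp add: mult_mono)
    also have "\<dots> = ?X powr chain_exponent CARD('d) c (Suc t)"
      by (simp add: powr_add mult_ac)
    finally show ?thesis .
  qed
qed

end

section \<open>The length of a chain\<close>

lemma real_vec_diff: "real_vec (x - y) = real_vec x - real_vec y"
  by (simp add: real_vec_def vec_eq_iff)

lemma inj_real_vec: "inj real_vec"
  by (rule injI) (simp add: real_vec_def vec_eq_iff)

lemma int_vec_real_vec: "int_vec (real_vec x)"
  by (simp add: int_vec_def real_vec_def)

lemma card_fibre_le_Max:
  "card {j \<in> {1..k::nat}. f j = n} \<le> (MAX n. card {j \<in> {1..k}. f j = n})"
proof (rule Max_ge)
  have "card {j \<in> {1..k}. f j = n} \<in> {..k}" for n
  proof -
    have "card {j \<in> {1..k}. f j = n} \<le> card {1..k}" by (intro card_mono) auto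
    then show ?thesis by simp
  qed
  then show "finite (range (\<lambda>n. card {j \<in> {1..k}. f j = n}))"
    by (meson finite_atMost finite_subset image_subsetI)
qed auto

theorem lemma4p1:
  fixes K :: "(real ^ 'b::finite) set"
  assumes "compact K"
  shows "\<exists>C0 C0'. \<forall>C \<ge> C0. \<forall>C' \<ge> C0'. \<exists>C0''. \<forall>C'' \<ge> C0''. \<exists>B0. \<forall>B \<ge> B0.
    \<forall>(lam :: real ^ 'b) (\<sigma> :: real) (B' :: real) (k :: nat)
      (\<xi> :: nat \<Rightarrow> (int ^ 'd::finite) \<times> (int ^ 'b)).
      lam \<in> K \<longrightarrow>
      (\<forall>P :: 'b int_mpoly.
         P \<noteq> 0 \<and> total_degree P < 10 * CARD('d) \<and>
         (\<forall>\<beta>. \<bar>real_of_int (Poly_Mapping.lookup P \<beta>)\<bar> < B powr C) \<longrightarrow>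
         \<bar>eval_mpoly P lam\<bar> > B powr (- C')) \<longrightarrow>
      inj_on \<xi> {1..k} \<longrightarrow>
      (\<forall>j\<in>{1..k}. \<bar>(lam \<bullet> real_vec (snd (\<xi> j)) + \<sigma>)\<^sup>2 - (norm (real_vec (fst (\<xi> j))))\<^sup>2\<bar> < B) \<longrightarrow>
      (\<forall>j\<in>{2..k}. lattice_norm (\<xi> j - \<xi> (j - 1)) < B) \<longrightarrow>
      real (MAX n. card {j \<in> {1..k}. fst (\<xi> j) = n}) < B' \<longrightarrow>
      real k < (B * B') powr C''"
proof -
  let ?d = "CARD('d)"
  let ?E = "frame_exponent ?d"
  let ?\<gamma> = "\<lambda>C'. chain_exponent (real ?d) (real (?E * (2 * ?d + 3) + 5) + C') DIM((real ^ 'd) \<times> (real ^ 'b))"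
  obtain \<Lambda> where \<Lambda>: "\<And>lam. lam \<in> K \<Longrightarrow> norm lam \<le> \<Lambda>"
    using compact_imp_bounded[OF assms] by (auto simp: bounded_iff)
  \<comment> \<open>\<open>\<Lambda>\<close> may be negative if \<open>K\<close> is empty.\<close>
  define B0 where "B0 = 5 + 4 * real ?d + real ?d * (real CARD('b))\<^sup>2 + \<Lambda>\<^sup>2 + real ?d * \<bar>\<Lambda>\<bar>"
  have main: "real k < (B * B') powr C''"
    if C: "real (?E * (2 * ?d + 2) + 2) \<le> C" "0 \<le> C'" "?\<gamma> C' + 1 \<le> C''" "B0 \<le> B" and lam: "lam \<in> K"
    and dioph: "\<forall>P :: 'b int_mpoly. P \<noteq> 0 \<and> total_degree P < 10 * ?d \<and>
         (\<forall>\<beta>. \<bar>real_of_int (Poly_Mapping.lookup P \<beta>)\<bar> < B powr C) \<longrightarrow> \<bar>eval_mpoly P lam\<bar> > B powr (- C')"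
    and inj: "inj_on \<xi> {1..k}"
    and cone: "\<forall>j\<in>{1..k}. \<bar>(lam \<bullet> real_vec (snd (\<xi> j)) + \<sigma>)\<^sup>2 - (norm (real_vec (fst (\<xi> j))))\<^sup>2\<bar> < B"
    and steps: "\<forall>j\<in>{2..k}. lattice_norm (\<xi> j - \<xi> (j - 1)) < B"
    and mult: "real (MAX n. card {j \<in> {1..k}. fst (\<xi> j) = n}) < B'"
    for C C' C'' B B' \<sigma> :: real and lam :: "real ^ 'b" and k and \<xi> :: "nat \<Rightarrow> (int ^ 'd) \<times> (int ^ 'b)"
  proof -
    define Y where "Y j = (real_vec (fst (\<xi> j)), real_vec (snd (\<xi> j)))" for j
    have fibre: "real (card {j \<in> {1..k}. fst (\<xi> j) = n}) < B'" for n
      using mult card_fibre_le_Max[of k "\<lambda>j. fst (\<xi> j)" n] by linarith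
    have B5: "5 \<le> B" using C(4) unfolding B0_def by (smt (verit) mult_nonneg_nonneg of_nat_0_le_iff zero_le_power2)
    interpret resonant_chain lam \<sigma> B C C' "\<bar>\<Lambda>\<bar>" Y k
    proof unfold_locales
      show "lattice_point (Y j)" for j by (simp add: Y_def lattice_point_def int_vec_real_vec)
      show "inj_on Y {1..k}"
      proof (rule inj_onI)
        fix x y assume xy: "x \<in> {1..k}" "y \<in> {1..k}" "Y x = Y y"
        then have "fst (\<xi> x) = fst (\<xi> y)" "snd (\<xi> x) = snd (\<xi> y)"
          unfolding Y_def by (blast dest: injD[OF inj_real_vec])+
        then show "x = y" using inj_onD[OF inj prod_eqI xy(1,2)] by blast
      qed
      show "norm (Y j - Y (j - 1)) < B" if "j \<in> {2..k}" for j
        using bspec[OF steps that] by (simp add: Y_def lattice_norm_def real_vec_diff)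
      show "B powr (- C') < \<bar>eval_mpoly P lam\<bar>"
        if P: "P \<noteq> 0" "total_degree P \<le> 2"
          "\<And>\<beta>. \<bar>real_of_int (Poly_Mapping.lookup P \<beta>)\<bar> < B powr C" for P :: "'b int_mpoly"
      proof -
        have "1 \<le> ?d" by simp
        then have "total_degree P < 10 * ?d" using P(2) by linarith
        then show ?thesis using dioph P by blast
      qed
      show "norm lam \<le> \<bar>\<Lambda>\<bar>" using \<Lambda>[OF lam] by simp
    qed (use cone C in \<open>auto simp: Y_def B0_def\<close>)
    show ?thesis
    proof (cases "k = 0")
      case True
      then show ?thesis using fibre[of 0] B5 by simp
    next
      case False
      have "1 \<in> {j \<in> {1..k}. fst (\<xi> j) = fst (\<xi> 1)}" using False by simp
      then have "0 < card {j \<in> {1..k}. fst (\<xi> j) = fst (\<xi> 1)}" by (intro card_gt_0_iff[THEN iffD2]) auto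
      then have B': "1 < B'" using fibre[of "fst (\<xi> 1)"] by linarith
      have X: "1 < B * B'" using B' B5 less_1_mult[of B B'] by simp
      have "real (card {j \<in> {1..k}. fst (Y j) = n}) \<le> B'" for n
      proof (cases "\<exists>m. n = real_vec m")
        case True
        then obtain m where "n = real_vec m" by blast
        then have "{j \<in> {1..k}. fst (Y j) = n} = {j \<in> {1..k}. fst (\<xi> j) = m}"
          by (auto simp: Y_def dest: injD[OF inj_real_vec])
        then show ?thesis using fibre[of m] by simp
      next
        case False
        then have "{j \<in> {1..k}. fst (Y j) = n} = {}" by (auto simp: Y_def)
        then show ?thesis using B' by (simp only: card.empty)
      qed
      then have "real ((k - 1) + 1) \<le> (B * B') powr ?\<gamma> C'"
        using B' False dim_subset_UNIV[of "step_set 1 (k - 1)"] by (intro chain_length_le[of B' 1 "k - 1"]) auto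
      also have "\<dots> < (B * B') powr C''" using X C(3) by (intro powr_less_mono) auto
      finally show ?thesis using False by simp
    qed
  qed
  show ?thesis
    by (rule exI[of _ "real (?E * (2 * ?d + 2) + 2)"], rule exI[of _ 0], intro allI impI,
        rule_tac x = "?\<gamma> C' + 1" in exI, intro allI impI, rule exI[of _ B0], intro allI impI)
       (rule main; assumption)
qed

end
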